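(* Let $\alpha\ge0$, let $f=h+\overline{g}\in\mathcal{W}^0_{\mathcal{H}}(\alpha)$ with $h(z)=z+\sum_{n\ge2}a_nz^n$ and $g(z)=\sum_{n\ge2}b_nz^n$, and suppose that $\{\varphi_n(r)\}_{n=0}^{\infty}\in\mathcal{G}$ satisfies $\varphi_n(1)=1$ for all $n\ge0$. Then $$r\varphi_0(r)+\sum_{n=2}^{\infty}\left(|a_n|+|b_n|\right)\varphi_n(r)\le d\left(f(0),\partial f(\mathbb{D})\right)\quad\text{for } |z|=r\le R_f(\alpha),$$ where $R_f(\alpha)$ is the unique positive root in $(0,1)$ of the equation $$r\varphi_0(r)+2\sum_{n=2}^{\infty}\frac{\varphi_n(r)}{\alpha n^2+(1-\alpha)n}=L_w(1),\qquad L_w(1)=1+\sum_{n=2}^{\infty}\frac{2(-1)^{n-1}}{\alpha n^2+(1-\alpha)n}.$$ The radius $R_f(\alpha)$ is best possible: there is a function in $\mathcal{W}^0_{\mathcal{H}}(\alpha)$ for which, for every $r\in(R_f(\alpha),1)$, the left-hand side of the inequality is strictly greater than the right-hand side.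
   Context: $\mathbb{D}$ is the open unit disk in $\mathbb{C}$; $d(\cdot,\cdot)$ is Euclidean distance and $\partial f(\mathbb{D})$ is the boundary of $f(\mathbb{D})$. For $\alpha\ge0$, $\mathcal{W}^0_{\mathcal{H}}(\alpha)$ is the class of complex-valued harmonic functions $f=h+\overline{g}$ on $\mathbb{D}$, with $h,g$ analytic in $\mathbb{D}$ of the form $h(z)=z+\sum_{n\ge2}a_nz^n$, $g(z)=\sum_{n\ge2}b_nz^n$ (so $h(0)=h'(0)-1=0$, $g(0)=g'(0)=0$), such that $$\operatorname{Re}\left(h'(z)+\alpha zh''(z)\right)>|g'(z)+\alpha zg''(z)|\quad\text{for all } z\in\mathbb{D}.$$ $\mathcal{G}$ is the set of all sequences $\{\varphi_n(r)\}_{n=0}^{\infty}$ of non-negative differentiable increasing functions on $[0,1)$ such that the series $\sum_{n=0}^{\infty}\varphi_n(r)$ and $\sum_{n=0}^{\infty}\varphi_n'(r)$ converge locally uniformly on $[0,1)$. The value $\varphi_n(1)$ is that of the continuous extension of $\varphi_n$ to $[0,1]$, i.e. $\varphi_n(1)=\lim_{r\to1^-}\varphi_n(r)$.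
   Formalization: A unique root R_f(α) in (0,1) need not exist (e.g. α=0, φ_2=0.9+0.1r, other φ_n=r^n), so the inequality and sharpness are stated when it does; if φ_0>0 on (0,1), it is proved to exist iff the left side of the equation at r=0 is less than L_w(1). *)

theory Defs
  imports "HOL-Complex_Analysis.Complex_Analysis"
begin

(* Only the values on the unit disk matter, and a 0, a 1, b 0, b 1 are irrelevant:
   the series start at index 2. *)
definition canonical_rep ::
    "(complex \<Rightarrow> complex) \<Rightarrow> (complex \<Rightarrow> complex) \<Rightarrow> (complex \<Rightarrow> complex) \<Rightarrow>
     (nat \<Rightarrow> complex) \<Rightarrow> (nat \<Rightarrow> complex) \<Rightarrow> bool" where
  "canonical_rep f h g a b \<longleftrightarrow>
     h holomorphic_on ball 0 1 \<and> g holomorphic_on ball 0 1 \<and>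
     (\<forall>z\<in>ball 0 1. (\<lambda>n. a (n + 2) * z ^ (n + 2)) sums (h z - z)) \<and>
     (\<forall>z\<in>ball 0 1. (\<lambda>n. b (n + 2) * z ^ (n + 2)) sums g z) \<and>
     (\<forall>z\<in>ball 0 1. f z = h z + cnj (g z))"

definition W0H :: "real \<Rightarrow> (complex \<Rightarrow> complex) set" where
  "W0H \<alpha> = {f. \<exists>h g a b. canonical_rep f h g a b \<and>
     (\<forall>z\<in>ball 0 1.
        Re (deriv h z + of_real \<alpha> * z * deriv (deriv h) z)
          > cmod (deriv g z + of_real \<alpha> * z * deriv (deriv g) z))}"

definition series_converges_locally_uniformly ::
    "(nat \<Rightarrow> real \<Rightarrow> real) \<Rightarrow> bool" where
  "series_converges_locally_uniformly u \<longleftrightarrow>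
     (\<forall>x\<in>{0..<1}. \<exists>U. open U \<and> x \<in> U \<and>
        uniformly_convergent_on (U \<inter> {0..<1}) (\<lambda>N r. \<Sum>n<N. u n r))"

(* "Increasing" is non-strict, so that phi_n(r) = r^n, with phi_0 constant, is included.
   At r = 0 the derivative is one-sided. *)
definition class_G :: "(nat \<Rightarrow> real \<Rightarrow> real) set" where
  "class_G = {\<phi>.
     (\<forall>n. \<forall>r\<in>{0..<1}. 0 \<le> \<phi> n r) \<and>
     (\<forall>n. mono_on {0..<1} (\<phi> n)) \<and>
     series_converges_locally_uniformly \<phi> \<and>
     (\<exists>\<phi>'. (\<forall>n. \<forall>r\<in>{0..<1}. (\<phi> n has_real_derivative \<phi>' n r) (at r within {0..<1})) \<and>
           series_converges_locally_uniformly \<phi>')}"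

definition coeff_denom :: "real \<Rightarrow> nat \<Rightarrow> real" where
  "coeff_denom \<alpha> n = \<alpha> * real n ^ 2 + (1 - \<alpha>) * real n"

definition Lw1 :: "real \<Rightarrow> real" where
  "Lw1 \<alpha> = 1 + (\<Sum>n. 2 * (-1) ^ (n + 2 - 1) / coeff_denom \<alpha> (n + 2))"

definition majorant :: "real \<Rightarrow> (nat \<Rightarrow> real \<Rightarrow> real) \<Rightarrow> real \<Rightarrow> real" where
  "majorant \<alpha> \<phi> r = r * \<phi> 0 r + 2 * (\<Sum>n. \<phi> (n + 2) r / coeff_denom \<alpha> (n + 2))"

definition is_root :: "real \<Rightarrow> (nat \<Rightarrow> real \<Rightarrow> real) \<Rightarrow> real \<Rightarrow> bool" where
  "is_root \<alpha> \<phi> R \<longleftrightarrow> R \<in> {0<..<1} \<and> majorant \<alpha> \<phi> R = Lw1 \<alpha>"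

(* Meaningful only if there is exactly one root in (0,1). *)
definition Rf :: "real \<Rightarrow> (nat \<Rightarrow> real \<Rightarrow> real) \<Rightarrow> real" where
  "Rf \<alpha> \<phi> = (THE R. is_root \<alpha> \<phi> R)"

definition bohr_sum ::
    "(nat \<Rightarrow> complex) \<Rightarrow> (nat \<Rightarrow> complex) \<Rightarrow> (nat \<Rightarrow> real \<Rightarrow> real) \<Rightarrow> real \<Rightarrow> real" where
  "bohr_sum a b \<phi> r =
     r * \<phi> 0 r + (\<Sum>n. (cmod (a (n + 2)) + cmod (b (n + 2))) * \<phi> (n + 2) r)"

definition boundary_dist :: "(complex \<Rightarrow> complex) \<Rightarrow> real" where
  "boundary_dist f = infdist (f 0) (frontier (f ` ball 0 1))"

end

theory Submission
  imports Defs
begin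

text \<open>For \<open>\<bar>e\<bar> = 1\<close> put \<open>F = h + e g\<close>. The hypothesis says that \<open>p = F' + \<alpha> z F''\<close> has positive
  real part and \<open>p(0) = 1\<close>. Since \<open>p\<close> has Taylor coefficients \<open>D\<^sub>n (a\<^sub>n + e b\<^sub>n)\<close> with
  \<open>D\<^sub>n = \<alpha> n\<^sup>2 + (1 - \<alpha>) n\<close>, Caratheodory's inequality gives \<open>\<bar>a\<^sub>n\<bar> + \<bar>b\<^sub>n\<bar> \<le> 2 / D\<^sub>n\<close>, so the
  Bohr sum is at most the majorant. Harnack's inequality compares \<open>p\<close> on each ray with
  \<open>(1 - t) / (1 + t) = K' + \<alpha> t K''\<close>, where \<open>K\<close> is the extremal function; integrating this
  first-order inequality yields \<open>\<bar>f(z)\<bar> \<ge> K(\<bar>z\<bar>)\<close>, and \<open>K(t) \<rightarrow> L\<^sub>w(1)\<close> as \<open>t \<rightarrow> 1\<close>. The map \<open>f\<close> is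
  injective, hence open, so every boundary point of its image is a limit of values \<open>f(z)\<close> with
  \<open>\<bar>z\<bar> \<rightarrow> 1\<close>, and is therefore at distance at least \<open>L\<^sub>w(1)\<close> from \<open>f(0) = 0\<close>. For \<open>f = K\<close> the point
  \<open>L\<^sub>w(1)\<close> itself is on the boundary and the Bohr sum equals the majorant.

  As \<^const>\<open>infdist\<close> to the empty set is \<open>0\<close>, one also has to rule out that \<open>f\<close> maps onto the
  whole plane.\<close>

section \<open>Functions with positive real part\<close>

text \<open>Cauchy's formula written as a mean over the circle: the differential supplies one factor
  of the boundary point, which lowers the denominator from power \<open>Suc k\<close> to
  \<open>k\<close>.\<close>

lemma has_integral_circle_coeff:
  assumes "f holomorphic_on ball 0 1" "0 < r" "r < 1"
  shows "((\<lambda>x. f (of_real r * exp (2 * of_real pi * \<i> * of_real x)) /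
                (of_real r * exp (2 * of_real pi * \<i> * of_real x)) ^ k)
          has_integral ((deriv ^^ k) f 0 / fact k)) {0..1}"
proof -
  have sub: "cball 0 r \<subseteq> ball (0::complex) 1" using assms by auto
  have "continuous_on (cball 0 r) f"
    using assms(1) sub holomorphic_on_imp_continuous_on continuous_on_subset by blast
  moreover have "f holomorphic_on ball 0 r"
    using assms(1) sub holomorphic_on_subset ball_subset_cball by blast
  ultimately have "((\<lambda>u. f u / (u-0) ^ (Suc k)) has_contour_integral
      ((2 * pi * \<i>) / (fact k) * (deriv ^^ k) f 0)) (circlepath 0 r)"
    using assms by (intro Cauchy_has_contour_integral_higher_derivative_circlepath) auto
  then have "((\<lambda>x. f (circlepath 0 r x) / (circlepath 0 r x) ^ (Suc k) * (2 * pi * \<i> * r * exp(2 * of_real pi * \<i> * x)))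
      has_integral ((2 * pi * \<i>) / (fact k) * (deriv ^^ k) f 0)) {0..1}"
    by (simp add: has_contour_integral vector_derivative_circlepath)
  then have "((\<lambda>x. (1 / (2 * pi * \<i>)) * (f (circlepath 0 r x) / (circlepath 0 r x) ^ (Suc k) * (2 * pi * \<i> * r * exp(2 * of_real pi * \<i> * x))))
      has_integral ((1 / (2 * pi * \<i>)) * ((2 * pi * \<i>) / (fact k) * (deriv ^^ k) f 0))) {0..1}"
    by (rule has_integral_mult_right)
  then show ?thesis
    using assms(2) by (simp add: circlepath field_simps)
qed

text \<open>For \<open>n \<ge> 1\<close> the conjugate of \<open>p\<close> contributes nothing to
  the n-th Fourier coefficient on a circle, so \<open>p\<close> may be replaced there by
  \<open>2 * Re p\<close>. This is positive with mean 2, which bounds the coefficient.\<close>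

theorem Caratheodory_coeff_bound:
  assumes sums: "\<And>z. z \<in> ball 0 1 \<Longrightarrow> (\<lambda>n. c n * z ^ n) sums p z"
    and pos: "\<And>z. z \<in> ball 0 1 \<Longrightarrow> Re (p z) > 0"
    and c0: "c 0 = 1" and n: "n \<ge> 1"
  shows "cmod (c n) \<le> 2"
proof -
  have hol: "p holomorphic_on ball 0 1"
    using sums by (intro power_series_holomorphic[of 0 1 c]) simp
  have coeff: "(deriv ^^ k) p 0 / fact k = c k" for k
  proof -
    have "eventually (\<lambda>u. u \<in> ball (0::complex) 1) (nhds 0)"
      by (rule eventually_nhds_in_open) auto
    then have "eventually (\<lambda>u. (\<lambda>n. fps_nth (Abs_fps c) n * u ^ n) sums p u) (nhds 0)"
      by eventually_elim (use sums in simp)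
    then have "p has_fps_expansion Abs_fps c" by (rule has_fps_expansionI)
    from fps_nth_fps_expansion[OF this, of k] show ?thesis by simp
  qed
  have bound: "cmod (c n) * r ^ n \<le> 2" if r: "0 < r" "r < 1" for r
  proof -
    define \<gamma> where "\<gamma> = (\<lambda>x::real. complex_of_real r * exp (2 * of_real pi * \<i> * of_real x))"
    have ncm: "cmod (\<gamma> x) = r" for x using r by (simp add: \<gamma>_def norm_mult)
    have nz: "\<gamma> x \<noteq> 0" for x using ncm[of x] r by auto
    have I1: "((\<lambda>x. p (\<gamma> x) / \<gamma> x ^ n) has_integral c n) {0..1}"
      using has_integral_circle_coeff[OF hol r, of n] coeff[of n] by (simp add: \<gamma>_def)
    have I0: "((\<lambda>x. p (\<gamma> x)) has_integral 1) {0..1}"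
      using has_integral_circle_coeff[OF hol r, of 0] coeff[of 0] c0 by (simp add: \<gamma>_def)
    \<comment> \<open>\<open>p z * z ^ n\<close> vanishes at 0, hence has mean 0 on the circle.
      Conjugating and dividing by \<open>r ^ (2 * n)\<close> turns
      \<open>cnj (\<gamma> x) ^ n\<close> into \<open>1 / \<gamma> x ^ n\<close>.\<close>
    have "(\<lambda>z. p z * z ^ n) holomorphic_on ball 0 1"
      using hol by (intro holomorphic_intros)
    from has_integral_circle_coeff[OF this r, of 0]
    have "((\<lambda>x. p (\<gamma> x) * \<gamma> x ^ n) has_integral 0) {0..1}"
      using n zero_power[of n, where 'a=complex] by (simp only: \<gamma>_def) simp
    then have "((\<lambda>x. cnj (p (\<gamma> x) * \<gamma> x ^ n)) has_integral 0) {0..1}"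
      using has_integral_cnj[of "\<lambda>x. p (\<gamma> x) * \<gamma> x ^ n" 0 "{0..1}"] by (simp add: o_def)
    from has_integral_mult_right[OF this, of "1 / of_real r ^ (2 * n)"]
    have I2: "((\<lambda>x. cnj (p (\<gamma> x)) / \<gamma> x ^ n) has_integral 0) {0..1}"
    proof (rule has_integral_eq_rhs[OF has_integral_eq, rotated])
      fix x :: real
      have "\<gamma> x * cnj (\<gamma> x) = of_real r ^ 2"
        using complex_norm_square[of "\<gamma> x"] by (simp only: ncm of_real_power)
      then have "of_real r ^ (2*n) = \<gamma> x ^ n * cnj (\<gamma> x) ^ n"
        by (simp only: power_mult power_mult_distrib[symmetric])
      then show "1 / of_real r ^ (2 * n) * cnj (p (\<gamma> x) * \<gamma> x ^ n) = cnj (p (\<gamma> x)) / \<gamma> x ^ n"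
        using nz[of x] by simp
    qed auto
    have I3: "((\<lambda>x. complex_of_real (2 * Re (p (\<gamma> x))) / \<gamma> x ^ n) has_integral c n) {0..1}"
      using has_integral_add[OF I1 I2]
      by (simp add: add_divide_distrib[symmetric] complex_add_cnj)
    have "((\<lambda>x. Re (p (\<gamma> x))) has_integral Re 1) {0..1}"
      using I0 by (rule has_integral_Re)
    from has_integral_mult_right[OF this, of "2 / r ^ n"]
    have I4: "((\<lambda>x. 2 / r ^ n * Re (p (\<gamma> x))) has_integral 2 / r ^ n) {0..1}" by simp
    have "norm (c n) \<le> 2 / r ^ n"
    proof -
      have "norm (integral {0..1} (\<lambda>x. complex_of_real (2 * Re (p (\<gamma> x))) / \<gamma> x ^ n))
          \<le> integral {0..1} (\<lambda>x. 2 / r ^ n * Re (p (\<gamma> x)))"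
      proof (rule integral_norm_bound_integral)
        fix x :: real
        have "Re (p (\<gamma> x)) > 0" using pos[of "\<gamma> x"] ncm[of x] r by simp
        then show "norm (complex_of_real (2 * Re (p (\<gamma> x))) / \<gamma> x ^ n) \<le> 2 / r ^ n * Re (p (\<gamma> x))"
          by (simp add: norm_divide norm_power ncm norm_mult)
      qed (use I3 I4 in blast)+
      then show ?thesis by (simp only: integral_unique[OF I3] integral_unique[OF I4])
    qed
    then show ?thesis using r by (simp add: field_simps)
  qed
  \<comment> \<open>The circles have radius below 1; the bound survives the limit r \<rightarrow>
    1.\<close>
  have "((\<lambda>r::real. cmod (c n) * r ^ n) \<longlongrightarrow> cmod (c n) * 1 ^ n) (at_left 1)"
    by (intro tendsto_intros)
  moreover have "eventually (\<lambda>r::real. cmod (c n) * r ^ n \<le> 2) (at_left 1)"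
    using eventually_at_leftI[of 0 "1::real"] bound by simp
  ultimately show ?thesis
    using tendsto_upperbound[of "\<lambda>r::real. cmod (c n) * r ^ n" "cmod (c n) * 1 ^ n" "at_left 1" 2] by simp
qed

text \<open>The Cayley transform \<open>w = (p - 1) / (p + 1)\<close> maps the disk into itself and
  fixes 0, so Schwarz gives \<open>cmod (w z) \<le> cmod z\<close>. Inverting, \<open>Re p\<close>
  is at least \<open>(1 - cmod w) / (1 + cmod w)\<close>, which decreases in
  \<open>cmod w\<close>.\<close>

theorem Harnack_lower_bound:
  assumes hol: "p holomorphic_on ball 0 1"
    and pos: "\<And>z. z \<in> ball 0 1 \<Longrightarrow> Re (p z) > 0"
    and p0: "p 0 = 1" and z: "z \<in> ball 0 1"
  shows "Re (p z) \<ge> (1 - cmod z) / (1 + cmod z)"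
proof -
  define w where "w = (\<lambda>z. (p z - 1) / (p z + 1))"
  have nz: "p u + 1 \<noteq> 0" if "u \<in> ball 0 1" for u
    using pos[OF that] by (auto simp: complex_eq_iff)
  have "w holomorphic_on ball 0 1" unfolding w_def
    using hol nz by (intro holomorphic_intros) auto
  moreover have "norm (w u) < 1" if "norm u < 1" for u
  proof -
    have "Re (p u) > 0" using pos that by simp
    then have "cmod (p u - 1) < cmod (p u + 1)"
      by (simp add: cmod_def power2_eq_square algebra_simps)
    then show ?thesis using nz[of u] that by (simp add: w_def norm_divide)
  qed
  ultimately have wz: "norm (w z) \<le> norm z"
    using Schwarz_Lemma(1)[of w z] z by (auto simp: w_def p0)
  have z1: "norm z < 1" using z by simp
  have w1: "1 - w z \<noteq> 0" using wz z1 by auto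
  have pw: "p z = (1 + w z) / (1 - w z)"
  proof -
    have "1 + w z = 2 * p z / (p z + 1)" "1 - w z = 2 / (p z + 1)"
      using nz[OF z] by (simp_all add: w_def field_simps)
    moreover have "p z = (2 * p z / (p z + 1)) / (2 / (p z + 1))"
      using nz[OF z] by simp
    ultimately show ?thesis by metis
  qed
  have "Re (p z) = (1 - (cmod (w z))\<^sup>2) / (cmod (1 - w z))\<^sup>2"
    unfolding pw by (simp add: Re_divide cmod_power2) (simp add: power2_eq_square algebra_simps)
  also have "\<dots> \<ge> (1 - (cmod (w z))\<^sup>2) / (1 + cmod (w z))\<^sup>2"
  proof (rule divide_left_mono)
    show "(cmod (1 - w z))\<^sup>2 \<le> (1 + cmod (w z))\<^sup>2"
      using norm_triangle_ineq4[of 1 "w z"] by (intro power_mono) auto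
    show "0 \<le> 1 - (cmod (w z))\<^sup>2" using wz z1 by (simp add: abs_square_le_1)
    have "0 < 1 + cmod (w z)" by (smt (verit) norm_ge_zero)
    then show "0 < (1 + cmod (w z))\<^sup>2 * (cmod (1 - w z))\<^sup>2" using w1 by simp
  qed
  also have "(1 - (cmod (w z))\<^sup>2) / (1 + cmod (w z))\<^sup>2 = (1 - cmod (w z)) / (1 + cmod (w z))"
  proof -
    have "1 + cmod (w z) \<noteq> 0" by (smt (verit) norm_ge_zero)
    then show ?thesis by (simp add: divide_simps power2_eq_square) (simp add: algebra_simps)
  qed
  finally have "(1 - cmod (w z)) / (1 + cmod (w z)) \<le> Re (p z)" .
  moreover have "(1 - cmod z) / (1 + cmod z) \<le> (1 - cmod (w z)) / (1 + cmod (w z))"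
    using wz z1 by (intro frac_le) (auto intro: add_pos_nonneg)
  ultimately show ?thesis by linarith
qed

section \<open>Comparison along rays\<close>

text \<open>On power series this operator multiplies the n-th coefficient by
  \<open>coeff_denom \<alpha> n\<close> and lowers the exponent by one; the denominators of the
  theorem arise from it.\<close>

definition euler_op :: "real \<Rightarrow> (complex \<Rightarrow> complex) \<Rightarrow> complex \<Rightarrow> complex" where
  "euler_op \<alpha> F z = deriv F z + of_real \<alpha> * z * deriv (deriv F) z"

lemma euler_op_holomorphic:
  assumes "F holomorphic_on ball 0 1"
  shows "euler_op \<alpha> F holomorphic_on ball 0 1"
  unfolding euler_op_def using assms by (intro holomorphic_intros) auto

lemma euler_op_sums:
  assumes sums: "\<And>z. z \<in> ball 0 1 \<Longrightarrow> (\<lambda>n. c n * z ^ n) sums F z"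
    and z: "z \<in> ball 0 1"
  shows "(\<lambda>n. of_real (coeff_denom \<alpha> (Suc n)) * c (Suc n) * z ^ n) sums euler_op \<alpha> F z"
proof -
  have hol: "F holomorphic_on ball 0 1"
    using sums by (intro power_series_holomorphic[of 0 1 c]) simp
  have "(F has_field_derivative deriv F u) (at u)"
    "(deriv F has_field_derivative deriv (deriv F) u) (at u)" if "u \<in> ball 0 1" for u
    using holomorphic_derivI[OF hol _ that] holomorphic_derivI[OF holomorphic_deriv[OF hol] _ that]
    by auto
  note der = this
  have s1: "(\<lambda>n. diffs c n * u ^ n) sums deriv F u" if "norm u < 1" for u
    by (rule termdiffs_sums_strong[of 1 c F]) (use that sums der in auto)
  have s2: "(\<lambda>n. diffs (diffs c) n * u ^ n) sums deriv (deriv F) u" if "norm u < 1" for u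
    by (rule termdiffs_sums_strong[of 1 "diffs c" "deriv F"]) (use that s1 der in auto)
  have zn: "norm z < 1" using z by simp
  have "(\<lambda>n. of_real \<alpha> * z * (diffs (diffs c) n * z ^ n)) sums (of_real \<alpha> * z * deriv (deriv F) z)"
    using s2[OF zn] by (rule sums_mult)
  then have "(\<lambda>n. of_real \<alpha> * of_nat (Suc n) * diffs c (Suc n) * z ^ (Suc n)) sums (of_real \<alpha> * z * deriv (deriv F) z)"
    by (simp add: diffs_def algebra_simps)
  \<comment> \<open>The factor \<open>of_nat n\<close> kills the term at index 0, so undoing the
    shift adds nothing.\<close>
  then have "(\<lambda>n. of_real \<alpha> * of_nat n * diffs c n * z ^ n) sums (of_real \<alpha> * z * deriv (deriv F) z)"
    using sums_Suc_iff[of "\<lambda>n. of_real \<alpha> * of_nat n * diffs c n * z ^ n"] by simp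
  from sums_add[OF s1[OF zn] this]
  have "(\<lambda>n. diffs c n * z ^ n + of_real \<alpha> * of_nat n * diffs c n * z ^ n) sums euler_op \<alpha> F z"
    by (simp add: euler_op_def)
  then show ?thesis
    by (simp add: diffs_def coeff_denom_def power2_eq_square algebra_simps)
qed

text \<open>At a nonpositive minimum \<open>m > 0\<close> of \<open>v\<close> one would have \<open>v' m \<le> 0\<close>.\<close>

lemma first_order_positivity:
  fixes v v' :: "real \<Rightarrow> real"
  assumes "\<alpha> \<ge> 0" "s \<ge> 0"
    and der: "\<And>t. 0 \<le> t \<Longrightarrow> t \<le> s \<Longrightarrow> (v has_real_derivative v' t) (at t)"
    and pos: "\<And>t. 0 \<le> t \<Longrightarrow> t \<le> s \<Longrightarrow> v t + \<alpha> * t * v' t > 0"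
  shows "v s > 0"
proof (rule ccontr)
  assume neg: "\<not> v s > 0"
  have "continuous_on {0..s} v"
    using der by (intro continuous_at_imp_continuous_on ballI) (auto intro: DERIV_isCont)
  then obtain m where m: "m \<in> {0..s}" "\<And>t. t \<in> {0..s} \<Longrightarrow> v m \<le> v t"
    using continuous_attains_inf[of "{0..s}" v] \<open>s \<ge> 0\<close> by auto
  have vm: "v m \<le> 0" using m(2)[of s] neg \<open>s \<ge> 0\<close> by auto
  \<comment> \<open>At \<open>m = 0\<close> the hypothesis reads \<open>v 0 > 0\<close>.\<close>
  have "m \<noteq> 0" using pos[of m] vm m(1) by auto
  then have m0: "m > 0" using m(1) by auto
  have "v' m \<le> 0"
  proof (rule ccontr)
    assume "\<not> v' m \<le> 0"
    then obtain d where d: "d > 0" "\<And>h. h > 0 \<Longrightarrow> h < d \<Longrightarrow> v (m - h) < v m"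
      using DERIV_pos_inc_left[OF der[of m]] m(1) by auto
    \<comment> \<open>The cap by \<open>m\<close> keeps \<open>m - h\<close> inside
      \<open>{0..s}\<close>, where \<open>v m\<close> is minimal.\<close>
    define h where "h = min (d/2) m"
    have "h > 0" "h < d" "h \<le> m" using d(1) m0 by (auto simp: h_def min_def)
    then have "v (m - h) < v m" using d(2) by blast
    moreover have "v m \<le> v (m - h)" using m(1) \<open>h > 0\<close> \<open>h \<le> m\<close> by (intro m(2)) auto
    ultimately show False by linarith
  qed
  then have "\<alpha> * m * v' m \<le> 0" using assms(1) m0 by (intro mult_nonneg_nonpos) auto
  then show False using pos[of m] vm m(1) by auto
qed

text \<open>The factor \<open>c\<close> covers two uses: \<open>c = 1\<close> for derivatives along
  a ray, and \<open>c = cnj u\<close> for the component of \<open>F\<close> in the direction of the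
  ray.\<close>

lemma has_real_derivative_radial:
  assumes hol: "F holomorphic_on ball 0 1" and u: "cmod u = 1" and t: "\<bar>t\<bar> < 1"
  shows "((\<lambda>t. Re (c * F (of_real t * u))) has_real_derivative
           Re (c * u * deriv F (of_real t * u))) (at t)"
proof -
  have "of_real t * u \<in> ball 0 1" using u t by (simp add: norm_mult)
  then have "(F has_field_derivative deriv F (of_real t * u)) (at (of_real t * u))"
    using holomorphic_derivI[OF hol] by auto
  moreover have "((\<lambda>x. x * u) has_field_derivative u) (at (of_real t))"
    by (auto intro!: derivative_eq_intros)
  ultimately have "((\<lambda>x. F (x * u)) has_field_derivative deriv F (of_real t * u) * u) (at (of_real t))"
    by (rule DERIV_chain2[where f = F])
  then have "((\<lambda>x. c * F (x * u)) has_field_derivative c * (deriv F (of_real t * u) * u)) (at (of_real t))"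
    by (rule DERIV_cmult)
  then have "((\<lambda>t. c * F (of_real t * u)) has_vector_derivative c * (deriv F (of_real t * u) * u)) (at t)"
    by (rule has_vector_derivative_real_field)
  from bounded_linear.has_vector_derivative[OF bounded_linear_Re this]
  show ?thesis by (simp add: has_real_derivative_iff_has_vector_derivative mult_ac)
qed

lemma ball_polar:
  assumes "z \<in> ball (0::complex) 1"
  obtains t u where "z = of_real t * u" "cmod u = 1" "0 \<le> t" "t < 1" "t = cmod z"
proof (cases "z = 0")
  case True
  then show ?thesis using that[of 0 1] by simp
next
  case False
  have "z = of_real (cmod z) * sgn z" using False
    by (simp add: sgn_div_norm scaleR_conv_of_real field_simps)
  then show ?thesis using that[of "cmod z" "sgn z"] assms False by (simp add: norm_sgn)
qed

text \<open>On the ray through \<open>u\<close> the operator becomes V + \<alpha> t V' with V the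
  real part of the derivative, the form that \<open>first_order_positivity\<close> treats.\<close>

lemma radial_euler_op:
  assumes hol: "F holomorphic_on ball 0 1" and u: "cmod u = 1" and t: "\<bar>t\<bar> < 1"
  shows "((\<lambda>t. Re (deriv F (of_real t * u))) has_real_derivative
           Re (u * deriv (deriv F) (of_real t * u))) (at t)"
    and "Re (euler_op \<alpha> F (of_real t * u)) =
         Re (deriv F (of_real t * u)) + \<alpha> * t * Re (u * deriv (deriv F) (of_real t * u))"
proof -
  show "((\<lambda>t. Re (deriv F (of_real t * u))) has_real_derivative
           Re (u * deriv (deriv F) (of_real t * u))) (at t)"
    using has_real_derivative_radial[of "deriv F" u t 1] assms holomorphic_deriv[OF hol] by simp
  have "complex_of_real \<alpha> * (of_real t * u) * deriv (deriv F) (of_real t * u)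
      = of_real (\<alpha> * t) * (u * deriv (deriv F) (of_real t * u))" by simp
  then show "Re (euler_op \<alpha> F (of_real t * u)) =
         Re (deriv F (of_real t * u)) + \<alpha> * t * Re (u * deriv (deriv F) (of_real t * u))"
    unfolding euler_op_def by (simp only: plus_complex.sel) simp
qed

lemma Re_deriv_pos:
  assumes "\<alpha> \<ge> 0" and hol: "F holomorphic_on ball 0 1"
    and pos: "\<And>z. z \<in> ball 0 1 \<Longrightarrow> Re (euler_op \<alpha> F z) > 0" and z: "z \<in> ball 0 1"
  shows "Re (deriv F z) > 0"
proof -
  obtain t u where tu: "z = of_real t * u" "cmod u = 1" "0 \<le> t" "t < 1"
    using ball_polar[OF z] by metis
  have "Re (deriv F (of_real t * u)) > 0"
  proof (rule first_order_positivity[OF assms(1) tu(3)])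
    fix x assume x: "0 \<le> x" "x \<le> t"
    then have ax: "\<bar>x\<bar> < 1" using tu by auto
    show "((\<lambda>t. Re (deriv F (of_real t * u))) has_real_derivative
           Re (u * deriv (deriv F) (of_real x * u))) (at x)"
      by (rule radial_euler_op(1)[OF hol tu(2) ax])
    have "of_real x * u \<in> ball 0 1" using ax tu(2) by (simp add: norm_mult)
    from pos[OF this] show "0 < Re (deriv F (of_real x * u)) + \<alpha> * x * Re (u * deriv (deriv F) (of_real x * u))"
      by (simp only: radial_euler_op(2)[OF hol tu(2) ax])
  qed
  then show ?thesis using tu by simp
qed

text \<open>Two integrations along the ray: the difference \<open>v\<close> of the real parts of the
  derivatives satisfies v + \<alpha> t v' \<ge> 0, so \<open>v \<ge> 0\<close>; and \<open>v\<close>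
  is the derivative of the difference \<open>w\<close> of the two sides, which starts at 0.\<close>

lemma radial_comparison:
  assumes "\<alpha> \<ge> 0" and hol: "F holomorphic_on ball 0 1" "K holomorphic_on ball 0 1"
    and zero: "F 0 = 0" "K 0 = 0"
    and le: "\<And>z. z \<in> ball 0 1 \<Longrightarrow> Re (euler_op \<alpha> K (of_real (cmod z))) \<le> Re (euler_op \<alpha> F z)"
    and u: "cmod u = 1" and t: "0 \<le> t" "t < 1"
  shows "Re (K (of_real t)) \<le> Re (cnj u * F (of_real t * u))"
proof -
  define v where "v = (\<lambda>t. Re (deriv F (of_real t * u)) - Re (deriv K (of_real t * 1)))"
  define v' where "v' = (\<lambda>t. Re (u * deriv (deriv F) (of_real t * u)) - Re (1 * deriv (deriv K) (of_real t * 1)))"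
  have dv: "(v has_real_derivative v' x) (at x)" if "\<bar>x\<bar> < 1" for x
    unfolding v_def v'_def
    by (intro DERIV_diff radial_euler_op(1) hol u that) simp
  have vpos: "v x + \<alpha> * x * v' x \<ge> 0" if "0 \<le> x" "x < 1" for x
  proof -
    have ax: "\<bar>x\<bar> < 1" using that by simp
    have "of_real x * u \<in> ball 0 1" using that u by (simp add: norm_mult)
    moreover have "cmod (of_real x * u) = x" using that u by (simp add: norm_mult)
    ultimately have "Re (euler_op \<alpha> K (of_real x * 1)) \<le> Re (euler_op \<alpha> F (of_real x * u))"
      using le[of "of_real x * u"] by simp
    then have "Re (deriv K (of_real x * 1)) + \<alpha> * x * Re (1 * deriv (deriv K) (of_real x * 1))
      \<le> Re (deriv F (of_real x * u)) + \<alpha> * x * Re (u * deriv (deriv F) (of_real x * u))"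
      using radial_euler_op(2)[OF hol(1) u ax] radial_euler_op(2)[OF hol(2) norm_one ax] by metis
    then show ?thesis by (simp add: v_def v'_def algebra_simps)
  qed
  have v0: "v x \<ge> 0" if "0 \<le> x" "x < 1" for x
  proof (rule field_le_epsilon)
    fix e :: real assume "e > 0"
    \<comment> \<open>\<open>first_order_positivity\<close> wants a strict inequality. Adding
      \<open>e\<close> leaves the derivative alone and raises v + \<alpha> t v' by
      \<open>e\<close>.\<close>
    have "v x + e > 0"
    proof (rule first_order_positivity[OF assms(1) that(1)])
      fix y assume y: "0 \<le> y" "y \<le> x"
      show "((\<lambda>x. v x + e) has_real_derivative v' y) (at y)"
        using dv[of y] y that by (auto intro!: derivative_eq_intros)
      show "0 < v y + e + \<alpha> * y * v' y" using vpos[of y] y that \<open>e > 0\<close> by simp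
    qed
    then show "0 \<le> v x + e" by simp
  qed
  define w where "w = (\<lambda>t. Re (cnj u * F (of_real t * u)) - Re (1 * K (of_real t * 1)))"
  have uu: "cnj u * u = 1" using u by (metis complex_norm_square mult.commute of_real_1 one_power2)
  \<comment> \<open>Differentiating brings out a factor \<open>u\<close>, which \<open>cnj u\<close>
    cancels.\<close>
  have dw: "(w has_real_derivative v x) (at x)" if "\<bar>x\<bar> < 1" for x
  proof -
    have "(w has_real_derivative
        (Re (cnj u * u * deriv F (of_real x * u)) - Re (1 * 1 * deriv K (of_real x * 1)))) (at x)"
      unfolding w_def by (intro DERIV_diff has_real_derivative_radial hol u that) simp
    then show ?thesis by (simp add: uu v_def)
  qed
  have "w 0 \<le> w t"
  proof (rule DERIV_nonneg_imp_nondecreasing[OF t(1)])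
    fix x assume "0 \<le> x" "x \<le> t"
    then show "\<exists>y. (w has_real_derivative y) (at x) \<and> 0 \<le> y"
      using t v0[of x] dw[of x] by auto
  qed
  then show ?thesis using zero by (simp add: w_def)
qed

section \<open>The extremal function\<close>

lemma coeff_denom_Suc: "coeff_denom \<alpha> (Suc n) = real (Suc n) * (1 + \<alpha> * real n)"
  by (simp add: coeff_denom_def power2_eq_square algebra_simps)

lemma coeff_denom_ge:
  assumes "\<alpha> \<ge> 0" "n \<ge> 1"
  shows "coeff_denom \<alpha> n \<ge> real n"
proof (cases n)
  case (Suc m)
  have "real (Suc m) * 1 \<le> real (Suc m) * (1 + \<alpha> * real m)"
    using assms(1) by (intro mult_left_mono) auto
  then show ?thesis unfolding Suc coeff_denom_Suc by simp
qed (use assms in simp)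

lemma coeff_denom_pos: "\<alpha> \<ge> 0 \<Longrightarrow> n \<ge> 1 \<Longrightarrow> coeff_denom \<alpha> n > 0"
  using coeff_denom_ge[of \<alpha> n] by auto

lemma coeff_denom_strict_mono:
  assumes "\<alpha> \<ge> 0" "n \<ge> 1"
  shows "coeff_denom \<alpha> n < coeff_denom \<alpha> (Suc n)"
proof (cases n)
  case (Suc m)
  have "1 + \<alpha> * real m > 0" using assms(1) by (intro add_pos_nonneg) auto
  then have "real (Suc m) * (1 + \<alpha> * real m) < real (Suc (Suc m)) * (1 + \<alpha> * real m)"
    by (intro mult_strict_right_mono) auto
  also have "\<dots> \<le> real (Suc (Suc m)) * (1 + \<alpha> * real (Suc m))"
    using assms(1) by (intro mult_left_mono add_left_mono) auto
  finally show ?thesis unfolding Suc coeff_denom_Suc .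
qed (use assms in simp)

text \<open>Chosen so that multiplication by \<open>coeff_denom \<alpha> n\<close> yields the Taylor
  coefficients of (1 - z) / (1 + z), the function with equality in Harnack's and Caratheodory's
  bounds.\<close>

definition extremal_coeff :: "real \<Rightarrow> nat \<Rightarrow> real" where
  "extremal_coeff \<alpha> n =
     (if n = 0 then 0 else if n = 1 then 1 else 2 * (-1) ^ (n - 1) / coeff_denom \<alpha> n)"

definition extremal :: "real \<Rightarrow> complex \<Rightarrow> complex" where
  "extremal \<alpha> z = (\<Sum>n. of_real (extremal_coeff \<alpha> n) * z ^ n)"

lemma extremal_coeff_bound: "\<alpha> \<ge> 0 \<Longrightarrow> \<bar>extremal_coeff \<alpha> n\<bar> \<le> 2"
  using coeff_denom_ge[of \<alpha> n]
  by (auto simp: extremal_coeff_def abs_mult power_abs divide_simps)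

lemma extremal_sums:
  assumes "\<alpha> \<ge> 0" "z \<in> ball 0 1"
  shows "(\<lambda>n. of_real (extremal_coeff \<alpha> n) * z ^ n) sums extremal \<alpha> z"
proof -
  have "summable (\<lambda>n. of_real (extremal_coeff \<alpha> n) * z ^ n)"
  proof (rule summable_comparison_test')
    show "summable (\<lambda>n. 2 * cmod z ^ n)"
      using assms(2) by (intro summable_mult summable_geometric) simp
    fix n :: nat
    show "norm (complex_of_real (extremal_coeff \<alpha> n) * z ^ n) \<le> 2 * cmod z ^ n"
      using extremal_coeff_bound[OF assms(1), of n]
      by (simp add: norm_mult norm_power mult_right_mono)
  qed
  then show ?thesis unfolding extremal_def by (rule summable_sums)
qed

lemma extremal_holomorphic: "\<alpha> \<ge> 0 \<Longrightarrow> extremal \<alpha> holomorphic_on ball 0 1"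
  using extremal_sums
  by (intro power_series_holomorphic[of 0 1 "\<lambda>n. of_real (extremal_coeff \<alpha> n)"]) simp

lemma extremal_0 [simp]: "extremal \<alpha> 0 = 0"
  by (simp add: extremal_def extremal_coeff_def)

lemma euler_op_extremal:
  assumes "\<alpha> \<ge> 0" "z \<in> ball 0 1"
  shows "euler_op \<alpha> (extremal \<alpha>) z = (1 - z) / (1 + z)"
proof -
  \<comment> \<open>The coefficients follow the pattern 2 (-1)^n except at \<open>n = 0\<close>,
    where the value is 1; this matches (1 - z) / (1 + z) = 2 / (1 + z) - 1.\<close>
  have *: "of_real (coeff_denom \<alpha> (Suc n)) * of_real (extremal_coeff \<alpha> (Suc n)) * z ^ n =
      2 * (-z) ^ n - (if n = 0 then 1 else 0)" for n
  proof -
    have "coeff_denom \<alpha> (Suc n) * extremal_coeff \<alpha> (Suc n) = 2 * (-1) ^ n - (if n = 0 then 1 else 0)"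
      using coeff_denom_pos[OF assms(1), of "Suc n"]
      by (cases "n = 0") (auto simp: extremal_coeff_def coeff_denom_Suc)
    then have "complex_of_real (coeff_denom \<alpha> (Suc n)) * of_real (extremal_coeff \<alpha> (Suc n)) =
        2 * (-1) ^ n - (if n = 0 then 1 else 0)"
      unfolding of_real_mult[symmetric] by simp
    then show ?thesis by (cases "n = 0") (simp_all add: power_minus[of z])
  qed
  have nz: "1 + z \<noteq> 0" using assms(2) by (auto simp: add_eq_0_iff)
  have "(\<lambda>n. (-z) ^ n) sums (1 / (1 - (-z)))"
    using assms(2) by (intro geometric_sums) simp
  from sums_diff[OF sums_mult[OF this, of 2] sums_single[of 0 "\<lambda>_. 1"]]
  have "(\<lambda>n. 2 * (-z) ^ n - (if n = 0 then 1 else 0)) sums (2 / (1 + z) - 1)" by simp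
  moreover have "(\<lambda>n. 2 * (-z) ^ n - (if n = 0 then 1 else 0)) sums euler_op \<alpha> (extremal \<alpha>) z"
    using euler_op_sums[OF extremal_sums[OF assms(1)] assms(2), of \<alpha>] unfolding * by simp
  ultimately have "euler_op \<alpha> (extremal \<alpha>) z = 2 / (1 + z) - 1" by (rule sums_unique2[symmetric])
  then show ?thesis using nz by (simp add: field_simps)
qed

lemma Re_euler_op_extremal_pos:
  assumes "\<alpha> \<ge> 0" "z \<in> ball 0 1"
  shows "Re (euler_op \<alpha> (extremal \<alpha>) z) > 0"
proof -
  have n: "cmod z < 1" using assms(2) by simp
  then have "(cmod z)\<^sup>2 < 1" by (simp add: power_less_one_iff abs_square_less_1)
  moreover have "1 + z \<noteq> 0" using n by (auto simp: add_eq_0_iff)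
  then have "(cmod (1 + z))\<^sup>2 > 0" by simp
  ultimately show ?thesis unfolding euler_op_extremal[OF assms]
    by (simp add: Re_divide cmod_power2) (simp add: power2_eq_square algebra_simps divide_pos_pos)
qed

text \<open>By \<open>Re_deriv_pos\<close> the real part increases strictly along the positive axis,
  starting from 0.\<close>

lemma Re_extremal_pos:
  assumes "\<alpha> \<ge> 0" "0 < t" "t < 1"
  shows "Re (extremal \<alpha> (of_real t)) > 0"
proof -
  have "Re (1 * extremal \<alpha> (of_real 0 * 1)) < Re (1 * extremal \<alpha> (of_real t * 1))"
  proof (rule DERIV_pos_imp_increasing[OF assms(2)])
    fix x assume x: "0 \<le> x" "x \<le> t"
    have "Re (deriv (extremal \<alpha>) (of_real x)) > 0"
      using Re_deriv_pos[OF assms(1) extremal_holomorphic[OF assms(1)]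
          Re_euler_op_extremal_pos[OF assms(1)], of "of_real x"] x assms by simp
    then show "\<exists>y. ((\<lambda>t. Re (1 * extremal \<alpha> (of_real t * 1))) has_real_derivative y) (at x) \<and> 0 < y"
      using has_real_derivative_radial[OF extremal_holomorphic[OF assms(1)], of 1 x 1] x assms by auto
  qed
  then show ?thesis by simp
qed

text \<open>Abel's limit theorem for the extremal function: the Leibniz error bound is uniform
  on \<open>[0, 1]\<close>.\<close>

lemma Leibniz_uniform:
  assumes "\<alpha> \<ge> 0"
  defines "S \<equiv> (\<lambda>t::real. \<Sum>n. (-1) ^ n * (t ^ (n + 2) / coeff_denom \<alpha> (n + 2)))"
  shows "\<And>t. t \<in> {0..1} \<Longrightarrow> summable (\<lambda>n. (-1) ^ n * (t ^ (n + 2) / coeff_denom \<alpha> (n + 2)))"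
    and "continuous_on {0..1} S" and "S 1 > 0"
proof -
  define b where "b = (\<lambda>(t::real) n. t ^ (n + 2) / coeff_denom \<alpha> (n + 2))"
  have b0: "0 \<le> b t n" "b t n \<le> 1 / real (n + 1)" if "t \<in> {0..1}" for t n
  proof -
    have D: "coeff_denom \<alpha> (n + 2) \<ge> real (n + 1)" "coeff_denom \<alpha> (n + 2) > 0"
      using coeff_denom_ge[OF assms(1), of "n + 2"] by auto
    then show "0 \<le> b t n" using that by (simp add: b_def)
    have "t ^ (n + 2) \<le> 1" using that by (intro power_le_one) auto
    then show "b t n \<le> 1 / real (n + 1)"
      unfolding b_def using D that by (intro frac_le) auto
  qed
  have lim: "b t \<longlonglongrightarrow> 0" if "t \<in> {0..1}" for t
    by (rule tendsto_sandwich[of "\<lambda>_. 0" _ _ "\<lambda>n. 1 / real (n + 1)"])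
       (use b0[OF that] LIMSEQ_inverse_real_of_nat in \<open>auto simp: inverse_eq_divide add.commute\<close>)
  have dec: "b t (Suc n) \<le> b t n" if "t \<in> {0..1}" for t n
    unfolding b_def
  proof (rule frac_le)
    show "t ^ (Suc n + 2) \<le> t ^ (n + 2)" using that by (intro power_decreasing) auto
    show "coeff_denom \<alpha> (n + 2) \<le> coeff_denom \<alpha> (Suc n + 2)"
      using coeff_denom_strict_mono[OF assms(1), of "n + 2"] by simp
  qed (use that coeff_denom_pos[OF assms(1)] in auto)
  note L = summable_Leibniz'[OF lim b0(1) dec]
  show sm: "\<And>t. t \<in> {0..1} \<Longrightarrow> summable (\<lambda>n. (-1) ^ n * (t ^ (n + 2) / coeff_denom \<alpha> (n + 2)))"
    using L(1) unfolding b_def by blast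
  have S: "S t = (\<Sum>n. (-1) ^ n * b t n)" for t by (simp add: S_def b_def)
  \<comment> \<open>Even partial sums lie below \<open>S\<close>, and one further term lifts them
    above it. The gap \<open>b t (2 * N)\<close> is at most \<open>1 / (2 * N + 1)\<close> for every
    \<open>t\<close>.\<close>
  have "uniform_limit {0..1} (\<lambda>N t. \<Sum>i<2*N. (-1) ^ i * b t i) S sequentially"
  proof (rule uniform_limitI)
    fix e :: real assume "e > 0"
    have "eventually (\<lambda>n. 1 / real (Suc n) < e) sequentially"
      using order_tendstoD(2)[OF LIMSEQ_inverse_real_of_nat \<open>e > 0\<close>] by (simp add: inverse_eq_divide)
    then show "\<forall>\<^sub>F N in sequentially. \<forall>t\<in>{0..1}. dist (\<Sum>i<2*N. (-1) ^ i * b t i) (S t) < e"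
    proof eventually_elim
      case (elim N)
      show ?case
      proof
        fix t :: real assume t: "t \<in> {0..1}"
        have "(\<Sum>i<2*N. (-1) ^ i * b t i) \<le> S t" "S t \<le> (\<Sum>i<2*N+1. (-1) ^ i * b t i)"
          unfolding S by (rule L(2,4)[OF t t t])+
        moreover have "b t (2 * N) \<le> 1 / real (2 * N + 1)" by (rule b0[OF t])
        moreover have "1 / real (2 * N + 1) \<le> 1 / real (Suc N)" by (intro divide_left_mono) auto
        ultimately show "dist (\<Sum>i<2*N. (-1) ^ i * b t i) (S t) < e"
          using elim by (simp add: dist_real_def)
      qed
    qed
  qed
  then show "continuous_on {0..1} S"
    by (rule uniform_limit_theorem[rotated])
       (use coeff_denom_pos[OF assms(1)] in \<open>auto simp: b_def less_imp_neq[symmetric] intro!: always_eventually continuous_intros\<close>)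
  \<comment> \<open>The alternating sum is at least the difference of its first two terms, which is
    positive as the denominators increase strictly.\<close>
  have "(\<Sum>i<2*1. (-1) ^ i * b 1 i) \<le> S 1" unfolding S by (rule L(2)) auto
  moreover have "b 1 1 < b 1 0"
    using coeff_denom_strict_mono[OF assms(1), of 2] coeff_denom_pos[OF assms(1), of 2]
    by (simp add: b_def eval_nat_numeral frac_less2)
  ultimately show "S 1 > 0" by (simp add: numeral_2_eq_2)
qed

lemma extremal_real_series:
  assumes "\<alpha> \<ge> 0" "0 \<le> t" "t < 1"
  shows "extremal \<alpha> (of_real t) =
    of_real (t - 2 * (\<Sum>n. (-1) ^ n * (t ^ (n + 2) / coeff_denom \<alpha> (n + 2))))"
proof -
  have "(\<lambda>n. (-1) ^ n * (t ^ (n + 2) / coeff_denom \<alpha> (n + 2))) sums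
      (\<Sum>n. (-1) ^ n * (t ^ (n + 2) / coeff_denom \<alpha> (n + 2)))"
    using Leibniz_uniform(1)[OF assms(1), of t] assms by (auto intro: summable_sums)
  from sums_mult[OF this, of "-2"]
  have "(\<lambda>n. extremal_coeff \<alpha> (n + 2) * t ^ (n + 2)) sums
     (-2 * (\<Sum>n. (-1) ^ n * (t ^ (n + 2) / coeff_denom \<alpha> (n + 2))))"
    by (simp add: extremal_coeff_def mult_ac)
  \<comment> \<open>The two terms left out so far are 0 and \<open>t\<close>.\<close>
  from sums_iff_shift[THEN iffD1, OF this]
  have "(\<lambda>n. extremal_coeff \<alpha> n * t ^ n) sums
     (t - 2 * (\<Sum>n. (-1) ^ n * (t ^ (n + 2) / coeff_denom \<alpha> (n + 2))))"
    by (simp add: eval_nat_numeral extremal_coeff_def)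
  then have "(\<lambda>n. complex_of_real (extremal_coeff \<alpha> n * t ^ n)) sums
     of_real (t - 2 * (\<Sum>n. (-1) ^ n * (t ^ (n + 2) / coeff_denom \<alpha> (n + 2))))"
    by (rule sums_of_real)
  moreover have "(\<lambda>n. complex_of_real (extremal_coeff \<alpha> n * t ^ n)) sums extremal \<alpha> (of_real t)"
    using extremal_sums[OF assms(1), of "of_real t"] assms by simp
  ultimately show ?thesis by (rule sums_unique2[symmetric])
qed

text \<open>The power of 1 is kept so that the sum is visibly the value at \<open>t = 1\<close> of
  the series in \<open>extremal_real_series\<close>.\<close>

lemma Lw1_eq:
  assumes "\<alpha> \<ge> 0"
  shows "Lw1 \<alpha> = 1 - 2 * (\<Sum>n. (-1) ^ n * (1 ^ (n + 2) / coeff_denom \<alpha> (n + 2)))"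
proof -
  have "(\<Sum>n. -2 * ((-1) ^ n * (1 ^ (n + 2) / coeff_denom \<alpha> (n + 2)))) =
     -2 * (\<Sum>n. (-1) ^ n * (1 ^ (n + 2) / coeff_denom \<alpha> (n + 2)))"
    using Leibniz_uniform(1)[OF assms, of 1] by (intro suminf_mult) auto
  then show ?thesis by (simp add: Lw1_def mult_ac)
qed

lemma Lw1_less_1: "\<alpha> \<ge> 0 \<Longrightarrow> Lw1 \<alpha> < 1"
  using Lw1_eq[of \<alpha>] Leibniz_uniform(3)[of \<alpha>] by simp

lemma Re_extremal_tendsto_Lw1:
  assumes "\<alpha> \<ge> 0"
  shows "((\<lambda>t. Re (extremal \<alpha> (of_real t))) \<longlongrightarrow> Lw1 \<alpha>) (at_left 1)"
proof -
  let ?S = "\<lambda>t::real. \<Sum>n. (-1) ^ n * (t ^ (n + 2) / coeff_denom \<alpha> (n + 2))"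
  have "(?S \<longlongrightarrow> ?S 1) (at 1 within {0..1})"
    using Leibniz_uniform(2)[OF assms] unfolding continuous_on_def by (rule bspec) simp
  then have "(?S \<longlongrightarrow> ?S 1) (at_left 1)"
    by (simp add: at_within_Icc_at_left)
  then have "((\<lambda>t. t - 2 * ?S t) \<longlongrightarrow> 1 - 2 * ?S 1) (at_left 1)" by (intro tendsto_intros)
  moreover have "eventually (\<lambda>t. t - 2 * ?S t = Re (extremal \<alpha> (of_real t))) (at_left 1)"
    by (rule eventually_at_leftI[of 0]) (auto simp: extremal_real_series[OF assms])
  ultimately show ?thesis unfolding Lw1_eq[OF assms] by (rule Lim_transform_eventually)
qed

lemma Lw1_nonneg: "\<alpha> \<ge> 0 \<Longrightarrow> Lw1 \<alpha> \<ge> 0"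
  by (rule tendsto_lowerbound[OF Re_extremal_tendsto_Lw1])
     (auto intro!: eventually_at_leftI[of 0] less_imp_le Re_extremal_pos)

section \<open>Stable harmonic maps\<close>

text \<open>Turns a bound valid for every \<open>h + e * g\<close> into one with the modulus of
  \<open>g\<close>, by taking the worst rotation \<open>- cnj w / cmod w\<close>.\<close>

lemma ex_unimodular_Re: "\<exists>e. cmod e = 1 \<and> Re (e * w) = - cmod w"
proof (cases "w = 0")
  case True
  then show ?thesis by (intro exI[of _ 1]) simp
next
  case False
  have "cnj w * w = of_real (cmod w) * of_real (cmod w)"
    using complex_norm_square[of w] by (simp only: of_real_power power2_eq_square mult.commute[of w] of_real_mult)
  then have "- cnj w / of_real (cmod w) * w = - of_real (cmod w)"
    using False by (simp only: times_divide_eq_left mult_minus_left) simp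
  then have "Re (- cnj w / of_real (cmod w) * w) = - cmod w" by (metis Re_complex_of_real uminus_complex.sel(1))
  moreover have "cmod (- cnj w / of_real (cmod w)) = 1" using False by (simp add: norm_divide)
  ultimately show ?thesis by blast
qed

text \<open>The rotation \<open>sgn x / sgn y\<close> aligns \<open>y\<close> with \<open>x\<close>,
  giving equality in the triangle inequality.\<close>

lemma ex_unimodular_add: "\<exists>e. cmod e = 1 \<and> cmod (x + e * y) = cmod x + cmod y"
proof (cases "x = 0 \<or> y = 0")
  case True
  then show ?thesis by (intro exI[of _ 1]) auto
next
  case False
  have "x + sgn x / sgn y * y = sgn x * of_real (cmod x + cmod y)"
    using False by (simp add: sgn_div_norm scaleR_conv_of_real field_simps)
  then have "cmod (x + sgn x / sgn y * y) = cmod x + cmod y"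
    using False by (simp add: norm_mult norm_sgn del: of_real_add)
  moreover have "cmod (sgn x / sgn y) = 1" using False by (simp add: norm_divide norm_sgn)
  ultimately show ?thesis by blast
qed

text \<open>Class membership for one fixed pair \<open>h\<close>, \<open>g\<close>, with the
  normalisation expressed by values and derivatives at 0 instead of coefficient sequences.\<close>

locale stable_pair =
  fixes \<alpha> :: real and f h g :: "complex \<Rightarrow> complex"
  assumes alpha: "\<alpha> \<ge> 0"
    and h_hol: "h holomorphic_on ball 0 1" and g_hol: "g holomorphic_on ball 0 1"
    and h_0: "h 0 = 0" and g_0: "g 0 = 0"
    and deriv_h_0: "deriv h 0 = 1" and deriv_g_0: "deriv g 0 = 0"
    and f_eq: "\<And>z. z \<in> ball 0 1 \<Longrightarrow> f z = h z + cnj (g z)"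
    and dominated: "\<And>z. z \<in> ball 0 1 \<Longrightarrow> cmod (euler_op \<alpha> g z) < Re (euler_op \<alpha> h z)"
begin

definition combo :: "complex \<Rightarrow> complex \<Rightarrow> complex" where
  "combo e z = h z + e * g z"

lemma combo_holomorphic: "combo e holomorphic_on ball 0 1"
  unfolding combo_def using h_hol g_hol by (intro holomorphic_intros)

lemma combo_0: "combo e 0 = 0"
  by (simp add: combo_def h_0 g_0)

lemma deriv_combo:
  assumes "z \<in> ball 0 1"
  shows "deriv (combo e) z = deriv h z + e * deriv g z"
proof -
  have "(h has_field_derivative deriv h z) (at z)" "(g has_field_derivative deriv g z) (at z)"
    using holomorphic_derivI[OF h_hol _ assms] holomorphic_derivI[OF g_hol _ assms] by auto
  then have "((\<lambda>z. h z + e * g z) has_field_derivative (deriv h z + e * deriv g z)) (at z)"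
    by (intro DERIV_add DERIV_cmult)
  then show ?thesis unfolding combo_def by (rule DERIV_imp_deriv)
qed

lemma euler_op_combo:
  assumes z: "z \<in> ball 0 1"
  shows "euler_op \<alpha> (combo e) z = euler_op \<alpha> h z + e * euler_op \<alpha> g z"
proof -
  have "eventually (\<lambda>w. w \<in> ball (0::complex) 1) (nhds z)"
    using z by (intro eventually_nhds_in_open) auto
  then have "eventually (\<lambda>w. deriv (combo e) w = deriv h w + e * deriv g w) (nhds z)"
    by eventually_elim (rule deriv_combo)
  then have "deriv (deriv (combo e)) z = deriv (\<lambda>w. deriv h w + e * deriv g w) z"
    by (intro deriv_cong_ev) auto
  also have "(deriv h has_field_derivative deriv (deriv h) z) (at z)"
    "(deriv g has_field_derivative deriv (deriv g) z) (at z)"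
    using holomorphic_derivI[OF holomorphic_deriv[OF h_hol] _ z]
      holomorphic_derivI[OF holomorphic_deriv[OF g_hol] _ z] by auto
  then have "((\<lambda>w. deriv h w + e * deriv g w) has_field_derivative
      (deriv (deriv h) z + e * deriv (deriv g) z)) (at z)"
    by (intro DERIV_add DERIV_cmult)
  then have "deriv (\<lambda>w. deriv h w + e * deriv g w) z = deriv (deriv h) z + e * deriv (deriv g) z"
    by (rule DERIV_imp_deriv)
  finally show ?thesis
    by (simp add: euler_op_def deriv_combo[OF z] algebra_simps)
qed

lemma Re_euler_op_combo_pos:
  assumes "cmod e = 1" "z \<in> ball 0 1"
  shows "Re (euler_op \<alpha> (combo e) z) > 0"
proof -
  have "\<bar>Re (e * euler_op \<alpha> g z)\<bar> \<le> cmod (euler_op \<alpha> g z)"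
    using abs_Re_le_cmod[of "e * euler_op \<alpha> g z"] assms(1) by (simp add: norm_mult)
  then show ?thesis using dominated[OF assms(2)] by (simp add: euler_op_combo[OF assms(2)])
qed

lemma euler_op_combo_0: "euler_op \<alpha> (combo e) 0 = 1"
  by (simp add: euler_op_combo) (simp add: euler_op_def deriv_h_0 deriv_g_0)

text \<open>Harnack's lower bound at \<open>z\<close> is exactly the operator applied to the
  extremal function at \<open>cmod z\<close>, so \<open>radial_comparison\<close> applies.\<close>

lemma combo_lower_bound:
  assumes "cmod e = 1" "cmod u = 1" "0 \<le> t" "t < 1"
  shows "Re (extremal \<alpha> (of_real t)) \<le> Re (cnj u * combo e (of_real t * u))"
proof (rule radial_comparison[OF alpha combo_holomorphic extremal_holomorphic[OF alpha]
      combo_0 extremal_0 _ assms(2-4)])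
  fix z :: complex assume z: "z \<in> ball 0 1"
  have "euler_op \<alpha> (extremal \<alpha>) (of_real (cmod z)) = (1 - of_real (cmod z)) / (1 + of_real (cmod z))"
    using z by (intro euler_op_extremal[OF alpha]) simp
  also have "\<dots> = of_real ((1 - cmod z) / (1 + cmod z))" by simp
  finally show "Re (euler_op \<alpha> (extremal \<alpha>) (of_real (cmod z))) \<le> Re (euler_op \<alpha> (combo e) z)"
    using Harnack_lower_bound[OF euler_op_holomorphic[OF combo_holomorphic]
        Re_euler_op_combo_pos[OF assms(1)] euler_op_combo_0 z] by simp
qed

text \<open>Positivity of the real part of the derivative of \<open>combo e\<close>, used for the
  \<open>e\<close> that makes the contribution of \<open>g\<close> most negative.\<close>

lemma deriv_dominated:
  assumes z: "z \<in> ball 0 1"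
  shows "cmod (deriv g z) < Re (deriv h z)"
proof -
  obtain e where e: "cmod e = 1" "Re (e * deriv g z) = - cmod (deriv g z)"
    using ex_unimodular_Re by blast
  have "Re (deriv (combo e) z) > 0"
    using Re_deriv_pos[OF alpha combo_holomorphic Re_euler_op_combo_pos[OF e(1)] z] .
  then show ?thesis using e(2) by (simp add: deriv_combo[OF z])
qed

text \<open>On the ray through \<open>u\<close> the choice \<open>e = u\<^sup>2\<close> gives
  \<open>Re (cnj u * combo e z) = Re (cnj u * f z)\<close>.\<close>

lemma growth:
  assumes z: "z \<in> ball 0 1"
  shows "Re (extremal \<alpha> (of_real (cmod z))) \<le> cmod (f z)"
proof -
  obtain t u where tu: "z = of_real t * u" "cmod u = 1" "0 \<le> t" "t < 1" "t = cmod z"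
    using ball_polar[OF z] by metis
  have uu: "cnj u * u = 1" using tu(2) by (metis complex_norm_square mult.commute of_real_1 one_power2)
  have "Re (extremal \<alpha> (of_real t)) \<le> Re (cnj u * combo (u\<^sup>2) z)"
    using combo_lower_bound[of "u\<^sup>2" u t] tu(2-4) by (simp add: norm_power tu(1)[symmetric])
  also have "cnj u * combo (u\<^sup>2) z = cnj u * h z + (cnj u * u) * (u * g z)"
    by (simp add: combo_def power2_eq_square algebra_simps)
  also have "Re \<dots> = Re (cnj u * f z)"
    unfolding uu f_eq[OF z] by (simp add: algebra_simps)
  also have "\<dots> \<le> cmod (cnj u * f z)" by (rule complex_Re_le_cmod)
  also have "\<dots> = cmod (f z)" using tu(2) by (simp add: norm_mult)
  finally show ?thesis using tu(5) by simp
qed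

text \<open>With \<open>e\<close> chosen so that \<open>e * g z\<close> points against the ray,
  \<open>combo_lower_bound\<close> still leaves a positive component. In particular \<open>h\<close>
  vanishes only at 0.\<close>

lemma g_less_h:
  assumes z: "z \<in> ball 0 1" "z \<noteq> 0"
  shows "cmod (g z) < cmod (h z)"
proof -
  obtain t u where tu: "z = of_real t * u" "cmod u = 1" "0 \<le> t" "t < 1" "t = cmod z"
    using ball_polar[OF z(1)] by metis
  obtain e where e: "cmod e = 1" "Re (e * (cnj u * g z)) = - cmod (cnj u * g z)"
    using ex_unimodular_Re by blast
  have "0 < Re (extremal \<alpha> (of_real t))"
    using Re_extremal_pos[OF alpha] tu(4,5) z(2) by simp
  also have "\<dots> \<le> Re (cnj u * combo e z)" using combo_lower_bound[OF e(1) tu(2-4)] by (simp add: tu(1)[symmetric])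
  also have "\<dots> = Re (cnj u * h z) + Re (e * (cnj u * g z))"
    by (simp add: combo_def algebra_simps)
  also have "\<dots> = Re (cnj u * h z) - cmod (g z)" using e(2) tu(2) by (simp add: norm_mult)
  also have "\<dots> \<le> cmod (cnj u * h z) - cmod (g z)" using complex_Re_le_cmod[of "cnj u * h z"] by simp
  finally show ?thesis using tu(2) by (simp add: norm_mult)
qed

text \<open>Noshiro-Warschawski argument: the component of \<open>f\<close> in direction
  \<open>c = b - a\<close> increases strictly along the segment from \<open>a\<close> to
  \<open>b\<close>. As \<open>Re (cnj c * cnj (g w)) = Re (c * g w)\<close>, it is the real part of
  an analytic expression, whose derivative is positive by \<open>deriv_dominated\<close>.\<close>

lemma f_inj: "inj_on f (ball 0 1)"
proof (rule inj_onI, rule ccontr)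
  fix a b assume a: "a \<in> ball 0 1" and b: "b \<in> ball 0 1" and fab: "f a = f b" and ne: "a \<noteq> b"
  define c where "c = b - a"
  define \<psi> where "\<psi> = (\<lambda>t::real. Re (cnj c * h (a + of_real t * c) + c * g (a + of_real t * c)))"
  have seg: "a + of_real t * c \<in> ball 0 1" if "0 \<le> t" "t \<le> 1" for t
  proof -
    have "closed_segment a b \<subseteq> ball 0 1"
      using a b by (intro closed_segment_subset convex_ball)
    moreover have "a + of_real t * c \<in> closed_segment a b"
      unfolding in_segment c_def using that
      by (intro exI[of _ t]) (simp add: scaleR_conv_of_real algebra_simps)
    ultimately show ?thesis by blast
  qed
  have val: "Re (cnj c * h w + c * g w) = Re (cnj c * f w)" if "w \<in> ball 0 1" for w
    using f_eq[OF that] by (simp add: algebra_simps)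
  have "\<psi> 0 < \<psi> 1"
  proof (rule DERIV_pos_imp_increasing[where f = \<psi>])
    fix x :: real assume x: "0 \<le> x" "x \<le> 1"
    let ?w = "a + of_real x * c"
    have d: "((\<lambda>t. a + t * c) has_field_derivative c) (at (of_real x))"
      by (auto intro!: derivative_eq_intros)
    have dh: "((\<lambda>t. h (a + t * c)) has_field_derivative deriv h ?w * c) (at (of_real x))"
      using DERIV_chain2[OF _ d, of h "deriv h ?w"] holomorphic_derivI[OF h_hol _ seg[OF x]] by auto
    have dg: "((\<lambda>t. g (a + t * c)) has_field_derivative deriv g ?w * c) (at (of_real x))"
      using DERIV_chain2[OF _ d, of g "deriv g ?w"] holomorphic_derivI[OF g_hol _ seg[OF x]] by auto
    have "((\<lambda>t. cnj c * h (a + t * c) + c * g (a + t * c)) has_field_derivative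
        cnj c * (deriv h ?w * c) + c * (deriv g ?w * c)) (at (of_real x))"
      by (intro DERIV_add DERIV_cmult dh dg)
    from bounded_linear.has_vector_derivative[OF bounded_linear_Re has_vector_derivative_real_field[OF this]]
    have "(\<psi> has_real_derivative Re (cnj c * (deriv h ?w * c) + c * (deriv g ?w * c))) (at x)"
      by (simp add: \<psi>_def has_real_derivative_iff_has_vector_derivative)
    moreover have "Re (cnj c * (deriv h ?w * c) + c * (deriv g ?w * c)) > 0"
    proof -
      have "cnj c * (deriv h ?w * c) = of_real ((cmod c)\<^sup>2) * deriv h ?w"
        by (simp only: complex_norm_square mult_ac)
      then have "Re (cnj c * (deriv h ?w * c)) = (cmod c)\<^sup>2 * Re (deriv h ?w)"
        by (simp only: Re_complex_of_real times_complex.sel Im_complex_of_real)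
      moreover have "\<bar>Re (c * (deriv g ?w * c))\<bar> \<le> (cmod c)\<^sup>2 * cmod (deriv g ?w)"
        using abs_Re_le_cmod[of "c * (deriv g ?w * c)"] by (simp add: norm_mult power2_eq_square mult_ac)
      moreover have "(cmod c)\<^sup>2 * cmod (deriv g ?w) < (cmod c)\<^sup>2 * Re (deriv h ?w)"
        using deriv_dominated[OF seg[OF x]] ne by (intro mult_strict_left_mono) (auto simp: c_def)
      ultimately show ?thesis by simp
    qed
    ultimately show "\<exists>y. (\<psi> has_real_derivative y) (at x) \<and> 0 < y" by blast
  qed simp
  moreover have "\<psi> 0 = Re (cnj c * f a)" "\<psi> 1 = Re (cnj c * f b)"
    using val[OF a] val[OF b] by (simp_all add: \<psi>_def c_def)
  ultimately show False using fab by simp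
qed

lemma f_continuous: "continuous_on (ball 0 1) f"
proof -
  have "continuous_on (ball 0 1) (\<lambda>z. h z + cnj (g z))"
    using h_hol g_hol by (intro continuous_intros holomorphic_on_imp_continuous_on)
  then show ?thesis by (rule continuous_on_eq) (simp add: f_eq)
qed

lemma f_open:
  assumes "U \<subseteq> ball 0 1" "open U"
  shows "open (f ` U)"
  using assms f_continuous f_inj
  by (intro invariance_of_domain) (auto intro: continuous_on_subset inj_on_subset)

text \<open>If \<open>w\<close> were attained at \<open>z0\<close>, a smaller disk around 0
  containing \<open>z0\<close> would have an open image around \<open>w\<close>. By injectivity
  almost all \<open>z n\<close> would lie in that disk, although their moduli tend to 1.\<close>

lemma boundary_limit_in_frontier:
  assumes z: "\<And>n. z n \<in> ball 0 1" and lim1: "(\<lambda>n. cmod (z n)) \<longlonglongrightarrow> 1"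
    and limf: "(\<lambda>n. f (z n)) \<longlonglongrightarrow> w"
  shows "w \<in> frontier (f ` ball 0 1)"
proof -
  have "w \<in> closure (f ` ball 0 1)"
    unfolding closure_sequential using z limf by (intro exI[of _ "\<lambda>n. f (z n)"]) auto
  moreover have "w \<notin> f ` ball 0 1"
  proof
    assume "w \<in> f ` ball 0 1"
    then obtain z0 where z0: "z0 \<in> ball 0 1" "w = f z0" by blast
    define d where "d = (1 + cmod z0) / 2"
    have d: "cmod z0 < d" "d < 1" using z0 by (auto simp: d_def)
    have "open (f ` ball 0 d)" using d by (intro f_open) auto
    moreover have "w \<in> f ` ball 0 d" using z0 d by simp
    ultimately have "eventually (\<lambda>n. f (z n) \<in> f ` ball 0 d) sequentially"
      using limf by (rule topological_tendstoD[rotated])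
    moreover have "eventually (\<lambda>n. d < cmod (z n)) sequentially"
      using lim1 d by (intro order_tendstoD)
    ultimately have "eventually (\<lambda>n. False) sequentially"
    proof eventually_elim
      case (elim n)
      then obtain y where y: "y \<in> ball 0 d" "f (z n) = f y" by blast
      then have "z n = y" using d by (intro inj_onD[OF f_inj _ z]) auto
      then show False using y elim by simp
    qed
    then show False by simp
  qed
  ultimately show ?thesis using interior_subset by (auto simp: frontier_def)
qed

text \<open>The maximum principle for \<open>z / h z\<close>, which equals \<open>1\<close> at the origin.\<close>

lemma ex_small_value:
  assumes r: "0 < r" "r < 1"
  shows "\<exists>z. cmod z = r \<and> cmod (h z) \<le> r"
proof -
  \<comment> \<open>This is \<open>h z / z\<close> with the singularity at 0 removed. It has no
    zeros by \<open>g_less_h\<close>, so the maximum principle applies to its reciprocal.\<close>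
  define k where "k = (\<lambda>z. if z = 0 then deriv h 0 else (h z - h 0) / (z - 0))"
  have k_hol: "k holomorphic_on ball 0 1"
    unfolding k_def by (rule pole_lemma[OF h_hol]) simp
  have k_nz: "k z \<noteq> 0" if "z \<in> ball 0 1" for z
    using g_less_h[OF that] by (auto simp: k_def deriv_h_0 h_0)
  have q_hol: "(\<lambda>z. 1 / k z) holomorphic_on ball 0 1"
    using k_hol k_nz by (intro holomorphic_intros) auto
  have sub: "cball 0 r \<subseteq> ball (0::complex) 1" using r by auto
  have q_cont: "continuous_on (cball 0 r) (\<lambda>z. 1 / k z)"
    using q_hol sub holomorphic_on_imp_continuous_on continuous_on_subset by blast
  have "\<exists>z0\<in>sphere 0 r. \<forall>y\<in>sphere (0::complex) r. norm (1 / k y) \<le> norm (1 / k z0)"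
  proof (rule continuous_attains_sup)
    show "continuous_on (sphere (0::complex) r) (\<lambda>z. norm (1 / k z))"
      using q_cont by (intro continuous_on_norm continuous_on_subset[OF q_cont]) auto
  qed (use r in auto)
  then obtain z0 where z0: "cmod z0 = r" "\<And>y. cmod y = r \<Longrightarrow> norm (1 / k y) \<le> norm (1 / k z0)"
    by (auto simp: dist_norm)
  have "norm (1 / k 0) \<le> norm (1 / k z0)"
  proof (rule maximum_modulus_frontier[of "\<lambda>z. 1 / k z" "ball 0 r"])
    show "(\<lambda>z. 1 / k z) holomorphic_on interior (ball 0 r)"
      using q_hol by (rule holomorphic_on_subset) (use r in auto)
    show "continuous_on (closure (ball 0 r)) (\<lambda>z. 1 / k z)" using q_cont r by simp
    show "norm (1 / k z) \<le> norm (1 / k z0)" if "z \<in> frontier (ball 0 r)" for z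
      using that r by (intro z0(2)) (simp add: frontier_ball)
  qed (use r in auto)
  moreover have "k 0 = 1" by (simp add: k_def deriv_h_0)
  moreover have "k z0 \<noteq> 0" using z0 r by (intro k_nz) simp
  ultimately have "1 \<le> 1 / cmod (k z0)" "cmod (k z0) > 0" by (simp_all add: norm_divide)
  then have "norm (k z0) \<le> 1" by (simp add: pos_le_divide_eq)
  moreover have "z0 \<noteq> 0" using z0 r by auto
  then have "h z0 = k z0 * z0" by (simp add: k_def h_0)
  ultimately have "cmod (h z0) \<le> r"
    using z0(1) r by (simp add: norm_mult mult_left_le_one_le)
  then show ?thesis using z0(1) by blast
qed

text \<open>\<open>ex_small_value\<close> and \<open>g_less_h\<close> give points with moduli
  tending to 1 at which \<open>f\<close> is bounded by 2. A convergent subsequence of the values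
  ends on the frontier.\<close>

lemma frontier_nonempty: "frontier (f ` ball 0 1) \<noteq> {}"
proof -
  have "\<exists>z. cmod z = 1 - inverse (real (Suc (Suc n))) \<and> cmod (h z) \<le> 1 - inverse (real (Suc (Suc n)))" for n
    by (rule ex_small_value) (auto simp: field_simps)
  then obtain z where z: "\<And>n. cmod (z n) = 1 - inverse (real (Suc (Suc n)))"
      "\<And>n. cmod (h (z n)) \<le> 1 - inverse (real (Suc (Suc n)))"
    by metis
  have zb: "z n \<in> ball 0 1" for n using z(1)[of n] by simp
  have "f (z n) \<in> cball 0 2" for n
  proof -
    have "z n \<noteq> 0" using z(1)[of n] by (auto simp: field_simps)
    then have "cmod (g (z n)) < cmod (h (z n))" using g_less_h[OF zb] by simp
    moreover have "cmod (h (z n)) \<le> 1" using z(2)[of n] by (smt (verit) inverse_nonnegative_iff_nonnegative of_nat_0_le_iff)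
    ultimately show ?thesis using norm_triangle_ineq[of "h (z n)" "cnj (g (z n))"] f_eq[OF zb[of n]] by simp
  qed
  then obtain w \<sigma> where w: "strict_mono (\<sigma> :: nat \<Rightarrow> nat)" "((\<lambda>n. f (z n)) \<circ> \<sigma>) \<longlonglongrightarrow> w"
    using compact_imp_seq_compact[OF compact_cball[of "0::complex" 2]] unfolding seq_compact_def by metis
  have "(\<lambda>n. 1 - inverse (real (Suc (Suc n)))) \<longlonglongrightarrow> 1 - 0"
    by (intro tendsto_diff tendsto_const LIMSEQ_Suc[OF LIMSEQ_inverse_real_of_nat])
  then have "(\<lambda>n. cmod (z n)) \<longlonglongrightarrow> 1" by (simp add: z(1))
  from LIMSEQ_subseq_LIMSEQ[OF this w(1)] have "(\<lambda>n. cmod (z (\<sigma> n))) \<longlonglongrightarrow> 1" by (simp add: o_def)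
  then have "w \<in> frontier (f ` ball 0 1)"
    using w(2) zb by (intro boundary_limit_in_frontier[of "\<lambda>n. z (\<sigma> n)"]) (auto simp: o_def)
  then show ?thesis by blast
qed

text \<open>For \<open>cmod w < Lw1 \<alpha>\<close>, growth sends all points near the unit circle
  away from \<open>w\<close>, so the image lies in a closed set \<open>A\<close> whose part near
  \<open>w\<close> is the image of a compact disk. Then \<open>w\<close> is attained, hence
  interior.\<close>

lemma frontier_norm_ge:
  assumes w: "w \<in> frontier (f ` ball 0 1)"
  shows "Lw1 \<alpha> \<le> cmod w"
proof (rule ccontr)
  assume "\<not> Lw1 \<alpha> \<le> cmod w"
  then have "cmod w < (cmod w + Lw1 \<alpha>) / 2" and less: "(cmod w + Lw1 \<alpha>) / 2 < Lw1 \<alpha>" by auto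
  note mid = this(1)
  have "eventually (\<lambda>t. (cmod w + Lw1 \<alpha>) / 2 < Re (extremal \<alpha> (of_real t))) (at_left 1)"
    using Re_extremal_tendsto_Lw1[OF alpha] less by (rule order_tendstoD)
  \<comment> \<open>If \<open>b\<close> is negative, \<open>cball 0 b\<close> is empty and the
    growth bound covers the whole disk.\<close>
  then obtain b where b: "b < 1" "\<And>t. b < t \<Longrightarrow> t < 1 \<Longrightarrow> (cmod w + Lw1 \<alpha>) / 2 < Re (extremal \<alpha> (of_real t))"
    by (auto simp: eventually_at_left[of 0 "1::real"])
  define A where "A = f ` cball 0 b \<union> {y. (cmod w + Lw1 \<alpha>) / 2 \<le> cmod y}"
  have sub: "cball 0 b \<subseteq> ball (0::complex) 1" using b by auto
  have "compact (f ` cball 0 b)"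
    by (intro compact_continuous_image continuous_on_subset[OF f_continuous sub] compact_cball)
  then have "closed A" unfolding A_def
    by (intro closed_Un compact_imp_closed closed_Collect_le continuous_intros)
  moreover have "f ` ball 0 1 \<subseteq> A"
  proof clarify
    fix z :: complex assume z: "z \<in> ball 0 1"
    show "f z \<in> A"
    proof (cases "cmod z \<le> b")
      case False
      then have "(cmod w + Lw1 \<alpha>) / 2 < Re (extremal \<alpha> (of_real (cmod z)))" using b z by simp
      then show ?thesis using growth[OF z] by (simp add: A_def)
    qed (simp add: A_def)
  qed
  ultimately have "closure (f ` ball 0 1) \<subseteq> A" by (rule closure_minimal[rotated])
  then have "w \<in> A" using w by (auto simp: frontier_def)
  then have "w \<in> f ` ball 0 1" using mid sub by (auto simp: A_def)
  moreover have "open (f ` ball 0 1)" by (rule f_open) auto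
  ultimately show False using w by (simp add: frontier_def interior_open)
qed

lemma f_0: "f 0 = 0"
  using f_eq[of 0] by (simp add: h_0 g_0)

theorem Lw1_le_boundary_dist: "Lw1 \<alpha> \<le> boundary_dist f"
  unfolding boundary_dist_def infdist_notempty[OF frontier_nonempty] f_0
  by (rule cINF_greatest[OF frontier_nonempty]) (use frontier_norm_ge in simp)

end

section \<open>Coefficient bounds and uniqueness of the canonical representation\<close>

lemma (in stable_pair) coeff_bound:
  assumes A: "\<And>z. z \<in> ball 0 1 \<Longrightarrow> (\<lambda>n. A n * z ^ n) sums h z"
    and B: "\<And>z. z \<in> ball 0 1 \<Longrightarrow> (\<lambda>n. B n * z ^ n) sums g z"
    and A1: "A 1 = 1" and B1: "B 1 = 0" and n: "n \<ge> 2"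
  shows "cmod (A n) + cmod (B n) \<le> 2 / coeff_denom \<alpha> n"
proof -
  \<comment> \<open>Caratheodory bounds a single coefficient of \<open>combo e\<close>; aligning the
    two summands makes its modulus the required sum.\<close>
  obtain e where e: "cmod e = 1" "cmod (A n + e * B n) = cmod (A n) + cmod (B n)"
    using ex_unimodular_add by blast
  have "(\<lambda>n. (A n + e * B n) * z ^ n) sums combo e z" if "z \<in> ball 0 1" for z
    using sums_add[OF A[OF that] sums_mult[OF B[OF that], of e]]
    by (simp add: combo_def algebra_simps)
  note p = euler_op_sums[OF this, of _ \<alpha>]
  \<comment> \<open>The operator lowers exponents, so the n-th coefficients sit at index
    \<open>n - 1\<close>; \<open>A 1 = 1\<close> and \<open>B 1 = 0\<close> give constant term
    1.\<close>
  have "cmod (of_real (coeff_denom \<alpha> (Suc (n - 1))) * (A (Suc (n - 1)) + e * B (Suc (n - 1)))) \<le> 2"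
    by (rule Caratheodory_coeff_bound[OF p Re_euler_op_combo_pos[OF e(1)]])
       (use n A1 B1 in \<open>simp_all add: coeff_denom_def\<close>)
  then have "coeff_denom \<alpha> n * (cmod (A n) + cmod (B n)) \<le> 2"
    using n coeff_denom_pos[OF alpha, of n] by (simp add: norm_mult e(2))
  then show ?thesis
    using n coeff_denom_pos[OF alpha, of n] by (simp add: pos_le_divide_eq mult.commute)
qed

text \<open>Entries of \<open>a\<close> and \<open>b\<close> below index 2 are arbitrary, so they
  are overwritten by the true Taylor coefficients.\<close>

lemma canonical_rep_sums:
  assumes "canonical_rep f h g a b" "z \<in> ball 0 1"
  shows "(\<lambda>n. (if n = 0 then 0 else if n = 1 then 1 else a n) * z ^ n) sums h z"
    and "(\<lambda>n. (if n < 2 then 0 else b n) * z ^ n) sums g z"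
proof -
  have "(\<lambda>n. a (n + 2) * z ^ (n + 2)) sums (h z - z)" "(\<lambda>n. b (n + 2) * z ^ (n + 2)) sums g z"
    using assms unfolding canonical_rep_def by blast+
  then show "(\<lambda>n. (if n = 0 then 0 else if n = 1 then 1 else a n) * z ^ n) sums h z"
    and "(\<lambda>n. (if n < 2 then 0 else b n) * z ^ n) sums g z"
    using sums_iff_shift'[of "\<lambda>n. (if n = 0 then 0 else if n = 1 then 1 else a n) * z ^ n" 2 "h z"]
      sums_iff_shift'[of "\<lambda>n. (if n < 2 then 0 else b n) * z ^ n" 2 "g z"]
    by (simp_all add: lessThan_Suc numeral_2_eq_2)
qed

lemma canonical_rep_at_0:
  assumes "canonical_rep f h g a b"
  shows "h 0 = 0" "g 0 = 0" "deriv h 0 = 1" "deriv g 0 = 0"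
proof -
  note s = canonical_rep_sums[OF assms]
  have z: "(0::complex) \<in> ball 0 1" by simp
  show "h 0 = 0" "g 0 = 0"
    using sums_unique2[OF s(1)[OF z] powser_sums_zero] sums_unique2[OF s(2)[OF z] powser_sums_zero]
    by simp_all
  \<comment> \<open>With parameter 0 the operator is the derivative, so \<open>euler_op_sums\<close>
    yields the first coefficient.\<close>
  have "euler_op 0 h 0 = 1"
    using sums_unique2[OF euler_op_sums[OF s(1) z, of 0] powser_sums_zero]
    by (simp add: coeff_denom_def)
  moreover have "euler_op 0 g 0 = 0"
    using sums_unique2[OF euler_op_sums[OF s(2) z, of 0] powser_sums_zero]
    by (simp add: coeff_denom_def)
  ultimately show "deriv h 0 = 1" "deriv g 0 = 0" by (simp_all add: euler_op_def)
qed

text \<open>By the open mapping theorem a nonconstant image would contain a point just above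
  \<open>F 0\<close>, off the real axis.\<close>

lemma holomorphic_real_valued_constant:
  assumes hol: "F holomorphic_on ball 0 1" and real: "\<And>z. z \<in> ball 0 1 \<Longrightarrow> F z \<in> \<real>"
    and z: "z \<in> ball 0 1"
  shows "F z = F 0"
proof -
  have "F constant_on ball 0 1"
  proof (rule ccontr)
    assume "\<not> F constant_on ball 0 1"
    then have "open (F ` ball 0 1)"
      by (intro open_mapping_thm[OF hol]) auto
    then obtain d where d: "d > 0" "ball (F 0) d \<subseteq> F ` ball 0 1"
      using open_contains_ball[of "F ` ball 0 1"] by (metis centre_in_ball imageI zero_less_one)
    have "F 0 + of_real (d / 2) * \<i> \<in> ball (F 0) d"
      using d(1) by (simp add: dist_norm norm_mult)
    then obtain w where "w \<in> ball 0 1" "F 0 + of_real (d / 2) * \<i> = F w"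
      using d(2) by (metis imageE subsetD)
    then have "F 0 + of_real (d / 2) * \<i> \<in> \<real>" using real[of w] by (simp only:)
    moreover have "F 0 \<in> \<real>" by (rule real) simp
    ultimately have "d / 2 = 0" by (simp add: complex_is_Real_iff)
    then show False using d(1) by simp
  qed
  then show ?thesis using z by (auto simp: constant_on_def)
qed

text \<open>If \<open>u = h - k\<close> and \<open>v = l - g\<close> satisfy \<open>u = cnj v\<close>, then \<open>u + v\<close> and \<open>\<i> (u - v)\<close> are
  real-valued and holomorphic.\<close>

lemma canonical_rep_unique:
  assumes r1: "canonical_rep f h g a b" and r2: "canonical_rep f k l a' b'" and z: "z \<in> ball 0 1"
  shows "h z = k z" "g z = l z"
proof -
  have hol: "h holomorphic_on ball 0 1" "g holomorphic_on ball 0 1"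
      "k holomorphic_on ball 0 1" "l holomorphic_on ball 0 1"
    using r1 r2 by (auto simp: canonical_rep_def)
  have eq: "h w - k w = cnj (l w - g w)" if "w \<in> ball 0 1" for w
  proof -
    have "f w = h w + cnj (g w)" "f w = k w + cnj (l w)"
      using r1 r2 that unfolding canonical_rep_def by blast+
    then show ?thesis unfolding complex_cnj_diff by algebra
  qed
  note zero = canonical_rep_at_0(1,2)[OF r1] canonical_rep_at_0(1,2)[OF r2]
  have "(h z - k z) + (l z - g z) = (h 0 - k 0) + (l 0 - g 0)"
  proof (rule holomorphic_real_valued_constant[OF _ _ z])
    show "(\<lambda>z. (h z - k z) + (l z - g z)) holomorphic_on ball 0 1"
      using hol by (intro holomorphic_intros)
    fix w :: complex assume "w \<in> ball 0 1"
    note e = eq[OF this]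
    show "(h w - k w) + (l w - g w) \<in> \<real>"
      unfolding e by (simp add: complex_is_Real_iff)
  qed
  moreover have "\<i> * ((h z - k z) - (l z - g z)) = \<i> * ((h 0 - k 0) - (l 0 - g 0))"
  proof (rule holomorphic_real_valued_constant[OF _ _ z])
    show "(\<lambda>z. \<i> * ((h z - k z) - (l z - g z))) holomorphic_on ball 0 1"
      using hol by (intro holomorphic_intros)
    fix w :: complex assume "w \<in> ball 0 1"
    note e = eq[OF this]
    show "\<i> * ((h w - k w) - (l w - g w)) \<in> \<real>"
      unfolding e by (simp add: complex_is_Real_iff)
  qed
  ultimately have "(h z - k z) + (l z - g z) = 0" "(h z - k z) - (l z - g z) = 0"
    by (simp_all add: zero)
  then have "2 * (h z - k z) = 0" "2 * (l z - g z) = 0" by algebra+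
  then show "h z = k z" "g z = l z" by simp_all
qed

lemma deriv_cong_ball:
  assumes "\<And>w. w \<in> ball 0 1 \<Longrightarrow> F w = G w" "z \<in> ball (0::complex) 1"
  shows "deriv F z = deriv G z"
proof -
  have "eventually (\<lambda>w. w \<in> ball (0::complex) 1) (nhds z)"
    using assms(2) by (intro eventually_nhds_in_open) auto
  then have "eventually (\<lambda>w. F w = G w) (nhds z)" by eventually_elim (rule assms(1))
  then show ?thesis by (intro deriv_cong_ev) auto
qed

lemma euler_op_cong_ball:
  assumes "\<And>w. w \<in> ball 0 1 \<Longrightarrow> F w = G w" "z \<in> ball (0::complex) 1"
  shows "euler_op \<alpha> F z = euler_op \<alpha> G z"
proof -
  have d: "deriv F w = deriv G w" if "w \<in> ball 0 1" for w
    by (rule deriv_cong_ball[OF assms(1) that])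
  have "deriv (deriv F) z = deriv (deriv G) z"
    by (rule deriv_cong_ball[OF d assms(2)])
  then show ?thesis unfolding euler_op_def d[OF assms(2)] by simp
qed

text \<open>Membership only provides some pair \<open>k\<close>, \<open>l\<close> with the dominance
  property. Uniqueness of the representation carries it over to the prescribed \<open>h\<close>,
  \<open>g\<close>.\<close>

lemma W0H_stable_pair:
  assumes "\<alpha> \<ge> 0" "f \<in> W0H \<alpha>" and rep: "canonical_rep f h g a b"
  shows "stable_pair \<alpha> f h g"
proof -
  obtain k l a' b' where rep': "canonical_rep f k l a' b'"
    and dom: "\<And>z. z \<in> ball 0 1 \<Longrightarrow> cmod (euler_op \<alpha> l z) < Re (euler_op \<alpha> k z)"
    using assms(2) by (auto simp: W0H_def euler_op_def)
  have eq: "euler_op \<alpha> h z = euler_op \<alpha> k z" "euler_op \<alpha> g z = euler_op \<alpha> l z"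
    if "z \<in> ball 0 1" for z
    using canonical_rep_unique[OF rep rep'] that by (blast intro: euler_op_cong_ball)+
  show ?thesis
  proof
    show "cmod (euler_op \<alpha> g z) < Re (euler_op \<alpha> h z)" if "z \<in> ball 0 1" for z
      unfolding eq[OF that] by (rule dom[OF that])
    show "f z = h z + cnj (g z)" if "z \<in> ball 0 1" for z
      using rep that unfolding canonical_rep_def by blast
    show "h holomorphic_on ball 0 1" "g holomorphic_on ball 0 1"
      using rep unfolding canonical_rep_def by blast+
  qed (rule assms(1) canonical_rep_at_0[OF rep])+
qed

lemma canonical_rep_coeff_bound:
  assumes "\<alpha> \<ge> 0" "f \<in> W0H \<alpha>" and rep: "canonical_rep f h g a b"
  shows "cmod (a (n + 2)) + cmod (b (n + 2)) \<le> 2 / coeff_denom \<alpha> (n + 2)"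
proof -
  interpret stable_pair \<alpha> f h g using assms by (rule W0H_stable_pair)
  note bound = coeff_bound[OF canonical_rep_sums(1)[OF rep] canonical_rep_sums(2)[OF rep], of "n + 2"]
  show ?thesis using bound by (simp del: mem_ball)
qed

section \<open>Sharpness: the extremal function as a member of the class\<close>

lemma canonical_rep_extremal:
  assumes "\<alpha> \<ge> 0"
  shows "canonical_rep (extremal \<alpha>) (extremal \<alpha>) (\<lambda>_. 0) (\<lambda>n. of_real (extremal_coeff \<alpha> n)) (\<lambda>_. 0)"
  unfolding canonical_rep_def
proof (intro conjI ballI)
  fix z :: complex assume z: "z \<in> ball 0 1"
  show "(\<lambda>n. of_real (extremal_coeff \<alpha> (n + 2)) * z ^ (n + 2)) sums (extremal \<alpha> z - z)"
    using extremal_sums[OF assms z]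
      sums_iff_shift'[of "\<lambda>n. of_real (extremal_coeff \<alpha> n) * z ^ n" 2 "extremal \<alpha> z"]
    by (simp add: eval_nat_numeral extremal_coeff_def)
qed (use extremal_holomorphic[OF assms] in auto)

lemma extremal_in_W0H:
  assumes "\<alpha> \<ge> 0"
  shows "extremal \<alpha> \<in> W0H \<alpha>"
proof -
  have "deriv (\<lambda>_. 0 :: complex) = (\<lambda>_. 0)" by (intro ext) simp
  then show ?thesis
    using canonical_rep_extremal[OF assms] Re_euler_op_extremal_pos[OF assms]
    unfolding W0H_def euler_op_def by fastforce
qed

text \<open>Along the positive axis the values are real and tend to \<open>Lw1 \<alpha>\<close>,
  which is therefore a frontier point at distance \<open>Lw1 \<alpha>\<close> from 0.\<close>

lemma boundary_dist_extremal_le: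
  assumes "\<alpha> \<ge> 0"
  shows "boundary_dist (extremal \<alpha>) \<le> Lw1 \<alpha>"
proof -
  interpret stable_pair \<alpha> "extremal \<alpha>" "extremal \<alpha>" "\<lambda>_. 0"
    using W0H_stable_pair[OF assms extremal_in_W0H[OF assms] canonical_rep_extremal[OF assms]] .
  define t where "t = (\<lambda>n. 1 - inverse (real (Suc (Suc n))))"
  have t: "0 < t n" "t n < 1" for n by (auto simp: t_def field_simps)
  have "t \<longlonglongrightarrow> 1 - 0" unfolding t_def
    by (intro tendsto_diff tendsto_const LIMSEQ_Suc[OF LIMSEQ_inverse_real_of_nat])
  then have t1: "t \<longlonglongrightarrow> 1" by simp
  then have "filterlim t (at_left 1) sequentially"
    using t less_imp_neq[OF t(2)] by (auto simp: filterlim_at)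
  from filterlim_compose[OF Re_extremal_tendsto_Lw1[OF assms] this]
  have "(\<lambda>n. complex_of_real (Re (extremal \<alpha> (of_real (t n))))) \<longlonglongrightarrow> of_real (Lw1 \<alpha>)"
    by (rule tendsto_of_real)
  moreover have "complex_of_real (Re (extremal \<alpha> (of_real (t n)))) = extremal \<alpha> (of_real (t n))" for n
    using extremal_real_series[OF assms, of "t n"] t[of n] by simp
  ultimately have "(\<lambda>n. extremal \<alpha> (of_real (t n))) \<longlonglongrightarrow> of_real (Lw1 \<alpha>)" by simp
  then have "complex_of_real (Lw1 \<alpha>) \<in> frontier (extremal \<alpha> ` ball 0 1)"
    using t t1 less_imp_le[OF t(1)]
    by (intro boundary_limit_in_frontier[of "\<lambda>n. of_real (t n)"]) (auto simp: abs_of_pos)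
  from infdist_le[OF this, of 0] show ?thesis
    using Lw1_nonneg[OF assms] by (simp add: boundary_dist_def)
qed

section \<open>The Bohr radius\<close>

lemma class_G_summable:
  assumes "\<phi> \<in> class_G" "0 \<le> r" "r < 1"
  shows "summable (\<lambda>n. \<phi> n r)"
proof -
  have "series_converges_locally_uniformly \<phi>" using assms(1) by (simp add: class_G_def)
  then obtain U where U: "r \<in> U" "uniformly_convergent_on (U \<inter> {0..<1}) (\<lambda>N r. \<Sum>n<N. \<phi> n r)"
    using assms(2,3) unfolding series_converges_locally_uniformly_def
    by (metis atLeastLessThan_iff)
  then have "convergent (\<lambda>N. \<Sum>n<N. \<phi> n r)"
    using assms U(1) by (intro uniformly_convergent_imp_convergent[OF U(2)]) auto
  then show ?thesis by (simp add: summable_iff_convergent)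
qed

lemma class_G_nonneg: "\<phi> \<in> class_G \<Longrightarrow> 0 \<le> r \<Longrightarrow> r < 1 \<Longrightarrow> 0 \<le> \<phi> n r"
  by (auto simp: class_G_def)

lemma class_G_mono: "\<phi> \<in> class_G \<Longrightarrow> 0 \<le> r \<Longrightarrow> r \<le> s \<Longrightarrow> s < 1 \<Longrightarrow> \<phi> n r \<le> \<phi> n s"
  by (auto simp: class_G_def mono_on_def)

lemma class_G_continuous: "\<phi> \<in> class_G \<Longrightarrow> continuous_on {0..<1} (\<phi> n)"
  unfolding class_G_def continuous_on_eq_continuous_within
  by (blast intro: DERIV_continuous)

text \<open>All denominators are at least 1, so \<open>\<phi> (n + 2) s\<close> dominates the terms
  on all of \<open>{0..s}\<close>, which serves both summability and the Weierstrass test.\<close>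

lemma majorant_term_le:
  assumes "\<alpha> \<ge> 0" "\<phi> \<in> class_G" "0 \<le> r" "r \<le> s" "s < 1"
  shows "\<phi> (n + 2) r / coeff_denom \<alpha> (n + 2) \<le> \<phi> (n + 2) s / coeff_denom \<alpha> (n + 2)"
    and "0 \<le> \<phi> (n + 2) r / coeff_denom \<alpha> (n + 2)"
    and "\<phi> (n + 2) r / coeff_denom \<alpha> (n + 2) \<le> \<phi> (n + 2) s"
proof -
  have D: "coeff_denom \<alpha> (n + 2) \<ge> 1"
    using coeff_denom_ge[OF assms(1), of "n + 2"] by simp
  have p: "0 \<le> \<phi> (n + 2) r" "\<phi> (n + 2) r \<le> \<phi> (n + 2) s"
    using class_G_nonneg[OF assms(2)] class_G_mono[OF assms(2)] assms by auto
  show *: "\<phi> (n + 2) r / coeff_denom \<alpha> (n + 2) \<le> \<phi> (n + 2) s / coeff_denom \<alpha> (n + 2)"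
    using p D by (intro divide_right_mono) auto
  show "0 \<le> \<phi> (n + 2) r / coeff_denom \<alpha> (n + 2)" using p D by simp
  have "\<phi> (n + 2) s * 1 \<le> \<phi> (n + 2) s * coeff_denom \<alpha> (n + 2)"
    using p D by (intro mult_left_mono) auto
  then have "\<phi> (n + 2) s / coeff_denom \<alpha> (n + 2) \<le> \<phi> (n + 2) s"
    using D by (simp add: pos_divide_le_eq)
  with * show "\<phi> (n + 2) r / coeff_denom \<alpha> (n + 2) \<le> \<phi> (n + 2) s" by linarith
qed

lemma class_G_summable_shift:
  assumes "\<phi> \<in> class_G" "0 \<le> r" "r < 1"
  shows "summable (\<lambda>n. \<phi> (n + 2) r)"
  using class_G_summable[OF assms] by (rule summable_ignore_initial_segment)

lemma majorant_summable:
  assumes "\<alpha> \<ge> 0" "\<phi> \<in> class_G" "0 \<le> r" "r < 1"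
  shows "summable (\<lambda>n. \<phi> (n + 2) r / coeff_denom \<alpha> (n + 2))"
proof (rule summable_comparison_test'[OF class_G_summable_shift[OF assms(2-4)]])
  show "norm (\<phi> (n + 2) r / coeff_denom \<alpha> (n + 2)) \<le> \<phi> (n + 2) r" for n
    unfolding real_norm_def abs_of_nonneg[OF majorant_term_le(2)[OF assms(1-3) order_refl assms(4)]]
    by (rule majorant_term_le(3)[OF assms(1-3) order_refl assms(4)])
qed

lemma majorant_continuous:
  assumes "\<alpha> \<ge> 0" "\<phi> \<in> class_G" "0 \<le> s" "s < 1"
  shows "continuous_on {0..s} (majorant \<alpha> \<phi>)"
proof -
  have cont: "continuous_on {0..s} (\<phi> n)" for n
    using class_G_continuous[OF assms(2)] by (rule continuous_on_subset) (use assms in auto)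
  have "uniform_limit {0..s} (\<lambda>N r. \<Sum>n<N. \<phi> (n + 2) r / coeff_denom \<alpha> (n + 2))
      (\<lambda>r. \<Sum>n. \<phi> (n + 2) r / coeff_denom \<alpha> (n + 2)) sequentially"
  proof (rule Weierstrass_m_test)
    show "summable (\<lambda>n. \<phi> (n + 2) s)" by (rule class_G_summable_shift[OF assms(2-4)])
    fix n r assume "r \<in> {0..s}"
    then show "norm (\<phi> (n + 2) r / coeff_denom \<alpha> (n + 2)) \<le> \<phi> (n + 2) s"
      using majorant_term_le(2,3)[OF assms(1,2) _ _ assms(4), of r n] by simp
  qed
  then have "continuous_on {0..s} (\<lambda>r. \<Sum>n. \<phi> (n + 2) r / coeff_denom \<alpha> (n + 2))"
  proof (rule uniform_limit_theorem[rotated])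
    have "coeff_denom \<alpha> (n + 2) \<noteq> 0" for n
      using coeff_denom_pos[OF assms(1), of "n + 2"] by simp
    then show "\<forall>\<^sub>F N in sequentially. continuous_on {0..s} (\<lambda>r. \<Sum>n<N. \<phi> (n + 2) r / coeff_denom \<alpha> (n + 2))"
      by (intro always_eventually allI continuous_intros cont ballI) auto
  qed simp
  then show ?thesis unfolding majorant_def by (intro continuous_intros cont)
qed

text \<open>The functions increase only weakly; strictness comes from the factor \<open>r\<close> in
  front of \<open>\<phi> 0 r\<close>.\<close>

lemma majorant_mono:
  assumes "\<alpha> \<ge> 0" "\<phi> \<in> class_G" "0 \<le> r" "r \<le> s" "s < 1"
  shows "majorant \<alpha> \<phi> r \<le> majorant \<alpha> \<phi> s"
    and "\<phi> 0 s > 0 \<Longrightarrow> r < s \<Longrightarrow> majorant \<alpha> \<phi> r < majorant \<alpha> \<phi> s"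
proof -
  have S: "(\<Sum>n. \<phi> (n + 2) r / coeff_denom \<alpha> (n + 2)) \<le> (\<Sum>n. \<phi> (n + 2) s / coeff_denom \<alpha> (n + 2))"
    using assms by (intro suminf_le majorant_term_le(1) majorant_summable) auto
  have P: "\<phi> 0 r \<le> \<phi> 0 s" "0 \<le> \<phi> 0 r" using assms class_G_mono class_G_nonneg by auto
  then have "r * \<phi> 0 r \<le> s * \<phi> 0 s" using assms by (intro mult_mono) auto
  with S show "majorant \<alpha> \<phi> r \<le> majorant \<alpha> \<phi> s" by (simp add: majorant_def)
  show "majorant \<alpha> \<phi> r < majorant \<alpha> \<phi> s" if "\<phi> 0 s > 0" "r < s"
  proof -
    have "r * \<phi> 0 r \<le> r * \<phi> 0 s" using P assms by (intro mult_left_mono) auto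
    also have "\<dots> < s * \<phi> 0 s" using that by simp
    finally show ?thesis using S by (simp add: majorant_def)
  qed
qed

text \<open>The series is nonnegative, so the majorant is at least \<open>r * \<phi> 0 r\<close>,
  which tends to 1.\<close>

lemma majorant_exceeds:
  assumes "\<alpha> \<ge> 0" "\<phi> \<in> class_G" and lim: "(\<phi> 0 \<longlongrightarrow> 1) (at_left 1)" and c: "c < 1"
  shows "\<exists>s. 0 < s \<and> s < 1 \<and> c < majorant \<alpha> \<phi> s"
proof -
  have "((\<lambda>r. r * \<phi> 0 r) \<longlongrightarrow> 1 * 1) (at_left 1)" using lim by (intro tendsto_intros)
  then have "eventually (\<lambda>r. c < r * \<phi> 0 r) (at_left 1)"
    using c by (intro order_tendstoD) auto
  then obtain d where d: "d < 1" "\<And>r. d < r \<Longrightarrow> r < 1 \<Longrightarrow> c < r * \<phi> 0 r"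
    by (auto simp: eventually_at_left[of 0 "1::real"])
  define s where "s = (max 0 d + 1) / 2"
  have s: "0 < s" "d < s" "s < 1" using d(1) by (auto simp: s_def)
  have "0 \<le> (\<Sum>n. \<phi> (n + 2) s / coeff_denom \<alpha> (n + 2))"
    using s by (intro suminf_nonneg majorant_summable majorant_term_le(2)[of _ _ _ s] assms) auto
  then have "s * \<phi> 0 s \<le> majorant \<alpha> \<phi> s" by (simp add: majorant_def)
  with d(2)[OF s(2,3)] show ?thesis using s by (intro exI[of _ s]) auto
qed

text \<open>Since \<open>Lw1 \<alpha> < 1\<close>, the majorant ends above the level, and continuity
  with strict growth leaves only the start to check. Members of \<open>class_G\<close> may be
  positive at 0, so starting below the level is a real condition.\<close>

lemma ex1_root_iff:
  assumes "\<alpha> \<ge> 0" "\<phi> \<in> class_G" and lim: "(\<phi> 0 \<longlongrightarrow> 1) (at_left 1)"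
    and pos: "\<forall>r\<in>{0<..<1}. \<phi> 0 r > 0"
  shows "(\<exists>!R. is_root \<alpha> \<phi> R) \<longleftrightarrow> majorant \<alpha> \<phi> 0 < Lw1 \<alpha>"
proof
  have strict: "majorant \<alpha> \<phi> r < majorant \<alpha> \<phi> s" if "0 \<le> r" "r < s" "s < 1" for r s
    using that pos by (intro majorant_mono(2)[OF assms(1,2)]) auto
  {
    assume "\<exists>!R. is_root \<alpha> \<phi> R"
    then obtain R where "is_root \<alpha> \<phi> R" by blast
    then show "majorant \<alpha> \<phi> 0 < Lw1 \<alpha>" using strict[of 0 R] by (simp add: is_root_def)
  }
  assume less: "majorant \<alpha> \<phi> 0 < Lw1 \<alpha>"
  obtain s where s: "0 < s" "s < 1" "Lw1 \<alpha> < majorant \<alpha> \<phi> s"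
    using majorant_exceeds[OF assms(1,2) lim Lw1_less_1[OF assms(1)]] by blast
  obtain R where R: "0 \<le> R" "R \<le> s" "majorant \<alpha> \<phi> R = Lw1 \<alpha>"
    using IVT'[of "majorant \<alpha> \<phi>" 0 "Lw1 \<alpha>" s] less s majorant_continuous[OF assms(1,2), of s]
    by auto
  have "is_root \<alpha> \<phi> R" using R s less by (cases "R = 0") (auto simp: is_root_def)
  moreover have "R' = R''" if "is_root \<alpha> \<phi> R'" "is_root \<alpha> \<phi> R''" for R' R''
    using that strict[of R' R''] strict[of R'' R'] unfolding is_root_def
    by (cases R' R'' rule: linorder_cases) auto
  ultimately show "\<exists>!R. is_root \<alpha> \<phi> R" by blast
qed

lemma bohr_sum_le_majorant:
  assumes "\<alpha> \<ge> 0" "\<phi> \<in> class_G" "f \<in> W0H \<alpha>" "canonical_rep f h g a b" "0 \<le> r" "r < 1"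
  shows "bohr_sum a b \<phi> r \<le> majorant \<alpha> \<phi> r"
proof -
  have le: "(cmod (a (n + 2)) + cmod (b (n + 2))) * \<phi> (n + 2) r \<le>
      2 * (\<phi> (n + 2) r / coeff_denom \<alpha> (n + 2))" for n
    using mult_right_mono[OF canonical_rep_coeff_bound[OF assms(1,3,4), of n]
        class_G_nonneg[OF assms(2,5,6), of "n + 2"]] by simp
  note sm = summable_mult[OF majorant_summable[OF assms(1,2,5,6)], of 2]
  have "summable (\<lambda>n. (cmod (a (n + 2)) + cmod (b (n + 2))) * \<phi> (n + 2) r)"
    by (rule summable_comparison_test'[OF sm])
       (use le class_G_nonneg[OF assms(2,5,6)] in \<open>simp add: abs_mult\<close>)
  from suminf_le[OF le this sm] show ?thesis
    unfolding bohr_sum_def majorant_def suminf_mult[OF majorant_summable[OF assms(1,2,5,6)]]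
    by (rule add_left_mono)
qed

lemma bohr_sum_extremal:
  assumes "\<alpha> \<ge> 0" "\<phi> \<in> class_G" "0 \<le> r" "r < 1"
  shows "bohr_sum (\<lambda>n. of_real (extremal_coeff \<alpha> n)) (\<lambda>_. 0) \<phi> r = majorant \<alpha> \<phi> r"
proof -
  have "(cmod (of_real (extremal_coeff \<alpha> (n + 2))) + cmod 0) * \<phi> (n + 2) r =
      2 * (\<phi> (n + 2) r / coeff_denom \<alpha> (n + 2))" for n
    using coeff_denom_pos[OF assms(1), of "n + 2"]
    by (simp add: extremal_coeff_def norm_divide norm_mult norm_power del: of_real_divide)
       (simp add: abs_mult power_abs)
  then show ?thesis
    unfolding bohr_sum_def majorant_def suminf_mult[OF majorant_summable[OF assms], symmetric]
    by simp
qed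

text \<open>A root can fail to exist when the majorant starts too high, so its existence and
  uniqueness are characterised first, and the inequality and its sharpness are stated for the case
  of a unique root. Where \<open>\<phi> 0\<close> vanishes the majorant can be constant, hence the
  positivity assumption in the first part.\<close>

theorem theorem3p2:
  fixes \<alpha> :: real and \<phi> :: "nat \<Rightarrow> real \<Rightarrow> real"
  assumes "\<alpha> \<ge> 0"
    and "\<phi> \<in> class_G"
    and "\<And>n. (\<phi> n \<longlongrightarrow> 1) (at_left 1)"
  shows "((\<forall>r\<in>{0<..<1}. \<phi> 0 r > 0) \<longrightarrow>
            ((\<exists>!R. is_root \<alpha> \<phi> R) \<longleftrightarrow> majorant \<alpha> \<phi> 0 < Lw1 \<alpha>))
    \<and> ((\<exists>!R. is_root \<alpha> \<phi> R) \<longrightarrow>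
         (\<forall>f h g a b. f \<in> W0H \<alpha> \<longrightarrow> canonical_rep f h g a b \<longrightarrow>
            (\<forall>r. 0 \<le> r \<and> r \<le> Rf \<alpha> \<phi> \<longrightarrow> bohr_sum a b \<phi> r \<le> boundary_dist f))
       \<and> (\<exists>f h g a b. f \<in> W0H \<alpha> \<and> canonical_rep f h g a b \<and>
            (\<forall>r. Rf \<alpha> \<phi> < r \<and> r < 1 \<longrightarrow> bohr_sum a b \<phi> r > boundary_dist f)))"
proof (rule conjI; rule impI)
  show "(\<exists>!R. is_root \<alpha> \<phi> R) \<longleftrightarrow> majorant \<alpha> \<phi> 0 < Lw1 \<alpha>" if "\<forall>r\<in>{0<..<1}. \<phi> 0 r > 0"
    using assms that by (intro ex1_root_iff)
next
  assume ex1: "\<exists>!R. is_root \<alpha> \<phi> R"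
  have root: "is_root \<alpha> \<phi> (Rf \<alpha> \<phi>)" unfolding Rf_def by (rule theI'[OF ex1])
  then have R: "0 < Rf \<alpha> \<phi>" "Rf \<alpha> \<phi> < 1" "majorant \<alpha> \<phi> (Rf \<alpha> \<phi>) = Lw1 \<alpha>"
    by (auto simp: is_root_def)
  show "(\<forall>f h g a b. f \<in> W0H \<alpha> \<longrightarrow> canonical_rep f h g a b \<longrightarrow>
            (\<forall>r. 0 \<le> r \<and> r \<le> Rf \<alpha> \<phi> \<longrightarrow> bohr_sum a b \<phi> r \<le> boundary_dist f))
       \<and> (\<exists>f h g a b. f \<in> W0H \<alpha> \<and> canonical_rep f h g a b \<and>
            (\<forall>r. Rf \<alpha> \<phi> < r \<and> r < 1 \<longrightarrow> bohr_sum a b \<phi> r > boundary_dist f))"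
  proof (intro conjI allI impI)
    fix f h g a b r
    assume f: "f \<in> W0H \<alpha>" and rep: "canonical_rep f h g a b" and r: "0 \<le> r \<and> r \<le> Rf \<alpha> \<phi>"
    have "bohr_sum a b \<phi> r \<le> majorant \<alpha> \<phi> r"
      using r R by (intro bohr_sum_le_majorant[OF assms(1,2) f rep]) auto
    also have "\<dots> \<le> majorant \<alpha> \<phi> (Rf \<alpha> \<phi>)"
      using r R by (intro majorant_mono(1)[OF assms(1,2)]) auto
    also have "\<dots> \<le> boundary_dist f"
      unfolding R(3) by (rule stable_pair.Lw1_le_boundary_dist[OF W0H_stable_pair[OF assms(1) f rep]])
    finally show "bohr_sum a b \<phi> r \<le> boundary_dist f" .
  next
    have "boundary_dist (extremal \<alpha>) < bohr_sum (\<lambda>n. of_real (extremal_coeff \<alpha> n)) (\<lambda>_. 0) \<phi> r"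
      if r: "Rf \<alpha> \<phi> < r \<and> r < 1" for r
    proof -
      have "Lw1 \<alpha> \<le> majorant \<alpha> \<phi> r"
        using majorant_mono(1)[OF assms(1,2), of "Rf \<alpha> \<phi>" r] r R by auto
      \<comment> \<open>Positivity of \<open>\<phi> 0\<close> is not at hand here, so strictness is
        drawn from uniqueness of the root instead of strict monotonicity.\<close>
      moreover have "majorant \<alpha> \<phi> r \<noteq> Lw1 \<alpha>"
      proof
        assume "majorant \<alpha> \<phi> r = Lw1 \<alpha>"
        then have "is_root \<alpha> \<phi> r" using r R by (auto simp: is_root_def)
        then show False using ex1 root r by auto
      qed
      ultimately show ?thesis
        using boundary_dist_extremal_le[OF assms(1)] bohr_sum_extremal[OF assms(1,2), of r] r R by auto
    qed
    then show "\<exists>f h g a b. f \<in> W0H \<alpha> \<and> canonical_rep f h g a b \<and>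
            (\<forall>r. Rf \<alpha> \<phi> < r \<and> r < 1 \<longrightarrow> bohr_sum a b \<phi> r > boundary_dist f)"
      using extremal_in_W0H[OF assms(1)] canonical_rep_extremal[OF assms(1)] by blast
  qed
qed

end
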